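(* Let $G$ be a non-amenable, non-elementary locally compact hyperbolic group. Then there is $N$ such that for every $p\geq N$, $G$ admits a metrically proper continuous affine isometric action on a finite $\ell_p$-direct sum of copies of $L_p(G)$ (with respect to right Haar measure) whose linear part is the direct sum of the natural right translation actions $\rho(g)f(\gamma)=f(\gamma g)$, and whose associated $1$-cocycle $c$ satisfies $\|c(g)\|\succeq |g|^{1/p}$, i.e. there are constants $C>0$, $M$ with $\|c(g)\|\geq C|g|^{1/p}$ whenever $|g|\geq M$ ($|g|$ the word length relative to a compact generating set). In particular $\alpha^*_p(G)\geq 1/p$ for all $p\geq N$.
   Context: A locally compact group $G$ is hyperbolic if it is compactly generated and word-hyperbolic with respect to the word length metric relative to some compact generating subset; equivalently it acts continuously, properly, cocompactly and isometrically on a proper geodesic hyperbolic metric space $X$, and $\partial G:=\partial X$. $G$ is non-elementary if $\partial G$ is infinite (equivalently uncountable). $\alpha^*_p(G)$ is the equivariant $L_p$-compression: the supremum over all $G$-equivariant coarse embeddings $f$ into $L_p$-spaces ($f(gh)=\alpha(g)f(h)$ for a continuous affine isometric action $\alpha$) of the supremum of $r\in[0,1]$ with $\frac1Cd(g,h)^r-D\leq\|f(g)-f(h)\|\leq Cd(g,h)$ for some $C,D>0$ and all $g,h$. *)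

theory Defs
  imports "HOL-Analysis.Analysis"
begin

text \<open>The group G is a type 'g of class topological_group_add (a possibly
 NON-commutative group, written additively: g + h is the product gh, -g the
 inverse, 0 the identity), Hausdorff (t2_space).\<close>

definition is_word :: "'g::group_add set \<Rightarrow> nat \<Rightarrow> 'g \<Rightarrow> bool" where
  "is_word S n g \<longleftrightarrow>
     (\<exists>xs. length xs = n \<and> set xs \<subseteq> S \<union> uminus ` S \<and> g = sum_list xs)"

definition generates :: "'g::group_add set \<Rightarrow> bool" where
  "generates S \<longleftrightarrow> (\<forall>g. \<exists>n. is_word S n g)"

definition word_length :: "'g::group_add set \<Rightarrow> 'g \<Rightarrow> real" where
  "word_length S g = real (LEAST n. is_word S n g)"

definition word_dist :: "'g::group_add set \<Rightarrow> 'g \<Rightarrow> 'g \<Rightarrow> real" where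
  "word_dist S g h = word_length S (- g + h)"

definition gromov_product :: "('a \<Rightarrow> 'a \<Rightarrow> real) \<Rightarrow> 'a \<Rightarrow> 'a \<Rightarrow> 'a \<Rightarrow> real" where
  "gromov_product d w x y = (d x w + d y w - d x y) / 2"

definition gromov_hyperbolic :: "('a \<Rightarrow> 'a \<Rightarrow> real) \<Rightarrow> bool" where
  "gromov_hyperbolic d \<longleftrightarrow> (\<exists>\<delta>\<ge>0. \<forall>w x y z.
     gromov_product d w x z \<ge> min (gromov_product d w x y) (gromov_product d w y z) - \<delta>)"

definition converges_at_infinity :: "('a \<Rightarrow> 'a \<Rightarrow> real) \<Rightarrow> 'a \<Rightarrow> (nat \<Rightarrow> 'a) \<Rightarrow> bool" where
  "converges_at_infinity d e x \<longleftrightarrow>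
     (\<forall>K. \<exists>N. \<forall>i j. i \<ge> N \<longrightarrow> j \<ge> N \<longrightarrow> gromov_product d e (x i) (x j) \<ge> K)"

definition boundary_equiv :: "('a \<Rightarrow> 'a \<Rightarrow> real) \<Rightarrow> 'a \<Rightarrow> (nat \<Rightarrow> 'a) \<Rightarrow> (nat \<Rightarrow> 'a) \<Rightarrow> bool" where
  "boundary_equiv d e x y \<longleftrightarrow>
     (\<forall>K. \<exists>N. \<forall>i \<ge> N. gromov_product d e (x i) (y i) \<ge> K)"

definition gromov_boundary :: "('a \<Rightarrow> 'a \<Rightarrow> real) \<Rightarrow> 'a \<Rightarrow> (nat \<Rightarrow> 'a) set set" where
  "gromov_boundary d e =
     {{y. converges_at_infinity d e y \<and> boundary_equiv d e x y} | x. converges_at_infinity d e x}"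

definition hyperbolic_lc_group :: "'g::{topological_group_add,t2_space} set \<Rightarrow> bool" where
  "hyperbolic_lc_group S \<longleftrightarrow>
     locally_compact_space (euclidean :: 'g topology) \<and>
     compact S \<and> generates S \<and> gromov_hyperbolic (word_dist S)"

definition non_elementary :: "'g::group_add set \<Rightarrow> bool" where
  "non_elementary S \<longleftrightarrow> infinite (gromov_boundary (word_dist S) 0)"

definition bcont :: "('g::topological_space \<Rightarrow> real) \<Rightarrow> bool" where
  "bcont f \<longleftrightarrow> continuous_on UNIV f \<and> bounded (range f)"

definition amenable_group :: "'g::{topological_group_add} itself \<Rightarrow> bool" where
  "amenable_group _ \<longleftrightarrow> (\<exists>m :: ('g \<Rightarrow> real) \<Rightarrow> real.
     (\<forall>f h a b. bcont f \<longrightarrow> bcont h \<longrightarrow> m (\<lambda>x. a * f x + b * h x) = a * m f + b * m h) \<and>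
     (\<forall>f. bcont f \<longrightarrow> (\<forall>x. f x \<ge> 0) \<longrightarrow> m f \<ge> 0) \<and>
     m (\<lambda>_. 1) = 1 \<and>
     (\<forall>f g. bcont f \<longrightarrow> m (\<lambda>x. f (g + x)) = m f))"

definition right_haar_measure :: "'g::{topological_group_add,t2_space} measure \<Rightarrow> bool" where
  "right_haar_measure M \<longleftrightarrow>
     sets M = sets borel \<and>
     (\<forall>A\<in>sets M. \<forall>g. emeasure M ((\<lambda>x. x + g) ` A) = emeasure M A) \<and>
     (\<forall>K. compact K \<longrightarrow> emeasure M K < \<infinity>) \<and>
     (\<forall>U. open U \<longrightarrow> U \<noteq> {} \<longrightarrow> emeasure M U > 0) \<and>
     (\<forall>A\<in>sets M. emeasure M A = (INF U\<in>{U. open U \<and> A \<subseteq> U}. emeasure M U)) \<and>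
     (\<forall>U. open U \<longrightarrow> emeasure M U = (SUP K\<in>{K. compact K \<and> K \<subseteq> U}. emeasure M K))"

text \<open>An element of the l_p-sum of n copies of L_p(M) is represented by
  v :: nat => 'g => real, the components being v i for i < n
  (elements of L_p are a.e.-classes; we work with representatives and the
  L_p (pseudo)distance).\<close>

definition Lp_sum :: "'g measure \<Rightarrow> real \<Rightarrow> nat \<Rightarrow> (nat \<Rightarrow> 'g \<Rightarrow> real) set" where
  "Lp_sum M p n = {v. \<forall>i<n. v i \<in> borel_measurable M \<and> integrable M (\<lambda>x. \<bar>v i x\<bar> powr p)}"

definition Lp_dist :: "'g measure \<Rightarrow> real \<Rightarrow> nat \<Rightarrow> (nat \<Rightarrow> 'g \<Rightarrow> real) \<Rightarrow> (nat \<Rightarrow> 'g \<Rightarrow> real) \<Rightarrow> real" where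
  "Lp_dist M p n v w = (\<Sum>i<n. integral\<^sup>L M (\<lambda>x. \<bar>v i x - w i x\<bar> powr p)) powr (1 / p)"

definition affine_action ::
  "('g::group_add \<Rightarrow> nat \<Rightarrow> 'g \<Rightarrow> real) \<Rightarrow> 'g \<Rightarrow> (nat \<Rightarrow> 'g \<Rightarrow> real) \<Rightarrow> (nat \<Rightarrow> 'g \<Rightarrow> real)" where
  "affine_action c g v = (\<lambda>i x. v i (x + g) + c g i x)"

definition continuous_affine_isometric_action ::
  "'g::{topological_group_add} measure \<Rightarrow> real \<Rightarrow> nat \<Rightarrow> ('g \<Rightarrow> nat \<Rightarrow> 'g \<Rightarrow> real) \<Rightarrow> bool" where
  "continuous_affine_isometric_action M p n c \<longleftrightarrow>
     (\<forall>g. \<forall>v\<in>Lp_sum M p n. affine_action c g v \<in> Lp_sum M p n) \<and>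
     (\<forall>v\<in>Lp_sum M p n. Lp_dist M p n (affine_action c 0 v) v = 0) \<and>
     (\<forall>g h. \<forall>v\<in>Lp_sum M p n.
        Lp_dist M p n (affine_action c (g + h) v) (affine_action c g (affine_action c h v)) = 0) \<and>
     (\<forall>g. \<forall>v\<in>Lp_sum M p n. \<forall>w\<in>Lp_sum M p n.
        Lp_dist M p n (affine_action c g v) (affine_action c g w) = Lp_dist M p n v w) \<and>
     (\<forall>g0. \<forall>v0\<in>Lp_sum M p n. \<forall>\<epsilon>>0. \<exists>U \<delta>. open U \<and> g0 \<in> U \<and> \<delta> > 0 \<and>
        (\<forall>g\<in>U. \<forall>v\<in>Lp_sum M p n. Lp_dist M p n v v0 < \<delta> \<longrightarrow>
           Lp_dist M p n (affine_action c g v) (affine_action c g0 v0) < \<epsilon>))"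

definition metrically_proper_action ::
  "'g::{topological_group_add} measure \<Rightarrow> real \<Rightarrow> nat \<Rightarrow> ('g \<Rightarrow> nat \<Rightarrow> 'g \<Rightarrow> real) \<Rightarrow> bool" where
  "metrically_proper_action M p n c \<longleftrightarrow>
     (\<forall>v\<in>Lp_sum M p n. \<forall>R. compact (closure {g. Lp_dist M p n (affine_action c g v) v \<le> R}))"

end

theory Submission
  imports Defs
begin

text \<open>Frink's chain construction turns the quasi-metric exp (- \<epsilon> (x|y)) into functions f on G whose
  increments f (x g) - f x decay like exp (- \<epsilon> |x|), and finitely many of them separate any two points
  that are far from the identity and lie in different directions. Balls grow at most exponentially,
  so c(g)(x) = f (x g) - f x is in L_p for large p. If x is the inverse of a point on a geodesic from
  the identity e to g, up to bounded error, then the translate by x of this geodesic passes near e, so x and x g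
  lie in different directions and c(g) is bounded below at x. By right invariance the set of such x has
  measure proportional to |g|, hence \<parallel>c(g)\<parallel>^p grows linearly in |g|.\<close>

section \<open>Word metrics\<close>

text \<open>Word distance is invariant under left translation, the measure under right translation.
  Since the linear part is right translation, x and x + g stay at the fixed distance |g| while x
  goes to infinity, and this is what makes the increments decay. If the functions f lay in L_p, the
  cocycle would be bounded; it can grow only because f is bounded without being p-integrable, so
  that c is a coboundary formally and not inside the space. Two obstacles follow. An infimum over
  chains has no regularity in x, so f is evaluated at a nearby point of a countable net. And
  continuity of the action has to be shown for a potential outside L_p: within a ball it is
  truncated to an L_p function, and beyond the ball its variation is controlled by an integrable
  tail. The threshold for p is a growth exponent of the balls divided by the parameter \<epsilon>,
  which depends on the hyperbolicity constant. The exponent 1/p arises because boundedly many points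
  of the geodesic share one translate: the disjoint sets that contribute to the norm are counted by
  |g|, each with a fixed contribution to the p-th power.\<close>

lemma is_word_0 [simp]: "is_word S 0 g \<longleftrightarrow> g = 0"
  by (auto simp: is_word_def)

lemma is_word_add:
  assumes "is_word S m g" "is_word S n h"
  shows "is_word S (m + n) (g + h)"
proof -
  from assms obtain xs ys where "length xs = m" "set xs \<subseteq> S \<union> uminus ` S" "g = sum_list xs"
    "length ys = n" "set ys \<subseteq> S \<union> uminus ` S" "h = sum_list ys"
    by (auto simp: is_word_def)
  then show ?thesis
    unfolding is_word_def by (intro exI[of _ "xs @ ys"]) auto
qed

lemma is_word_add_split:
  assumes "is_word S (m + n) g"
  obtains h where "is_word S m h" "is_word S n (- h + g)"
proof -
  from assms obtain xs where xs: "length xs = m + n" "set xs \<subseteq> S \<union> uminus ` S" "g = sum_list xs"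
    by (auto simp: is_word_def)
  have "g = sum_list (take m xs) + sum_list (drop m xs)"
    using xs by (metis append_take_drop_id sum_list_append)
  then have "- sum_list (take m xs) + g = sum_list (drop m xs)"
    by simp
  moreover have "set (take m xs) \<subseteq> S \<union> uminus ` S" "set (drop m xs) \<subseteq> S \<union> uminus ` S"
    using xs(2) by (meson order_trans set_take_subset set_drop_subset)+
  moreover from this have "is_word S m (sum_list (take m xs))"
    using xs(1) unfolding is_word_def by (intro exI[of _ "take m xs"]) simp
  moreover from calculation have "is_word S n (sum_list (drop m xs))"
    using xs(1) unfolding is_word_def by (intro exI[of _ "drop m xs"]) simp
  ultimately show ?thesis
    using that by simp
qed

lemma is_word_uminus:
  fixes g :: "'g::group_add"
  assumes "is_word S n g"
  shows "is_word S n (- g)"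
proof -
  from assms obtain xs where xs: "length xs = n" "set xs \<subseteq> S \<union> uminus ` S" "g = sum_list xs"
    by (auto simp: is_word_def)
  have *: "- sum_list ys = sum_list (rev (map uminus ys))" for ys :: "'g list"
    by (induction ys) (simp_all add: minus_add)
  have "set (rev (map uminus xs)) \<subseteq> S \<union> uminus ` S"
    using xs(2) by force
  then show ?thesis
    unfolding is_word_def using xs * by (intro exI[of _ "rev (map uminus xs)"]) simp
qed

locale generated_group =
  fixes S :: "'g::group_add set"
  assumes generates: "generates S"
begin

definition len :: "'g \<Rightarrow> nat" where
  "len g = (LEAST n. is_word S n g)"

lemma word_length_eq: "word_length S g = real (len g)"
  by (simp add: word_length_def len_def)

lemma is_word_len: "is_word S (len g) g"
  unfolding len_def using generates by (auto simp: generates_def intro: LeastI_ex)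

lemma len_le: "is_word S n g \<Longrightarrow> len g \<le> n"
  unfolding len_def by (rule Least_le)

lemma len_0 [simp]: "len 0 = 0"
  using len_le[of 0 0] by simp

lemma len_add_le: "len (g + h) \<le> len g + len h"
  by (intro len_le is_word_add is_word_len)

lemma len_uminus [simp]: "len (- g) = len g"
proof -
  have "len (- h) \<le> len h" for h
    by (intro len_le is_word_uminus is_word_len)
  from this[of g] this[of "- g"] show ?thesis by simp
qed

definition dst :: "'g \<Rightarrow> 'g \<Rightarrow> nat" where
  "dst g h = len (- g + h)"

lemma word_dist_eq: "word_dist S g h = real (dst g h)"
  by (simp add: word_dist_def dst_def word_length_eq)

lemma dst_commute: "dst g h = dst h g"
proof -
  have "- (- g + h) = - h + g" by (simp add: minus_add)
  then show ?thesis unfolding dst_def by (metis len_uminus)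
qed

lemma dst_triangle: "dst g k \<le> dst g h + dst h k"
proof -
  have "- g + k = (- g + h) + (- h + k)"
    by (simp add: add.assoc)
  then show ?thesis unfolding dst_def by (metis len_add_le)
qed

lemma dst_0 [simp]: "dst 0 g = len g" "dst g 0 = len g"
  by (simp_all add: dst_def)

lemma dst_add [simp]: "dst g (g + h) = len h"
  by (simp add: dst_def add.assoc[symmetric])

section \<open>Gromov products based at the identity\<close>

definition gp :: "'g \<Rightarrow> 'g \<Rightarrow> real" where
  "gp x y = (real (len x) + real (len y) - real (dst x y)) / 2"

lemma gromov_product_eq: "gromov_product (word_dist S) 0 x y = gp x y"
  by (simp add: gromov_product_def gp_def word_dist_eq)

lemma gp_commute: "gp x y = gp y x"
  by (simp add: gp_def dst_commute)

lemma gp_nonneg: "0 \<le> gp x y"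
  using dst_triangle[of x y 0] by (simp add: gp_def)

text \<open>Right translation by g displaces all points equally, by \<open>len g\<close>, so x and x
  + g look alike from the identity once x is far away. This is the source of the decay of the
  cocycle.\<close>

lemma gp_add_ge: "gp x (x + g) \<ge> real (len x) - real (len g)"
  using dst_triangle[of x 0 "x + g"] dst_triangle[of 0 x "x + g"]
    dst_triangle[of "x + g" x 0] dst_commute[of "x + g" x]
  by (simp add: gp_def)

text \<open>The two lengths change by at most q each and the distance by at most 2q; the factor 1/2
  in \<open>gp\<close> turns the total 4q into 2q. This pays for rounding points to a net.\<close>

lemma gp_perturb:
  assumes "dst x x' \<le> q" "dst y y' \<le> q"
  shows "\<bar>gp x' y' - gp x y\<bar> \<le> 2 * real q"
proof -
  have "len x' \<le> len x + dst x x'" "len x \<le> len x' + dst x x'"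
    using dst_triangle[of 0 x' x] dst_triangle[of 0 x x'] by (simp_all add: dst_commute)
  moreover have "len y' \<le> len y + dst y y'" "len y \<le> len y' + dst y y'"
    using dst_triangle[of 0 y' y] dst_triangle[of 0 y y'] by (simp_all add: dst_commute)
  moreover have "dst x' y' \<le> dst x x' + dst x y + dst y y'"
    using dst_triangle[of x' y' x] dst_triangle[of x y' y] by (simp add: dst_commute)
  moreover have "dst x y \<le> dst x x' + dst x' y' + dst y y'"
    using dst_triangle[of x y x'] dst_triangle[of x' y y'] by (simp add: dst_commute)
  ultimately have "real (len x') + real (len y') \<le> real (len x) + real (len y) + 2 * real q"
    "real (len x) + real (len y) \<le> real (len x') + real (len y') + 2 * real q"
    "real (dst x' y') \<le> real (dst x y) + 2 * real q" "real (dst x y) \<le> real (dst x' y') + 2 * real q"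
    using assms by linarith+
  then show ?thesis
    unfolding gp_def abs_le_iff by (auto simp: field_simps)
qed

text \<open>Cut a shortest word after i letters; the triangle inequality forbids either piece to be
  shorter than expected.\<close>

lemma geodesic_point:
  assumes "i \<le> len g"
  obtains h where "len h = i" "dst h g = len g - i"
proof -
  have "is_word S (i + (len g - i)) g"
    using is_word_len[of g] assms by simp
  then obtain h where "is_word S i h" "is_word S (len g - i) (- h + g)"
    by (rule is_word_add_split)
  then have h: "len h \<le> i" "dst h g \<le> len g - i"
    by (auto simp: dst_def intro: len_le)
  moreover have "len g \<le> len h + dst h g"
    using dst_triangle[of 0 g h] by simp
  ultimately show ?thesis
    using assms that[of h] by linarith
qed

lemma geodesic:
  obtains \<gamma> where "\<And>i. i \<le> len g \<Longrightarrow> len (\<gamma> i) = i"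
    "\<And>i. i \<le> len g \<Longrightarrow> dst (\<gamma> i) g = len g - i"
    "\<And>i j. i \<le> j \<Longrightarrow> j \<le> len g \<Longrightarrow> dst (\<gamma> i) (\<gamma> j) = j - i"
proof -
  obtain xs where xs: "length xs = len g" "set xs \<subseteq> S \<union> uminus ` S" "g = sum_list xs"
    using is_word_len[of g] by (auto simp: is_word_def)
  define \<gamma> where "\<gamma> i = sum_list (take i xs)" for i
  have word: "is_word S (j - i) (- \<gamma> i + \<gamma> j)" if "i \<le> j" "j \<le> len g" for i j
  proof -
    have "take j xs = take i xs @ drop i (take j xs)"
      using that(1) by (metis append_take_drop_id min.absorb1 take_take)
    then have "\<gamma> j = \<gamma> i + sum_list (drop i (take j xs))"
      unfolding \<gamma>_def by (metis sum_list_append)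
    then have "- \<gamma> i + \<gamma> j = sum_list (drop i (take j xs))"
      by (simp add: add.assoc[symmetric])
    moreover have "set (drop i (take j xs)) \<subseteq> S \<union> uminus ` S"
      using xs(2) by (meson order_trans set_drop_subset set_take_subset)
    ultimately show ?thesis
      using that xs(1) by (auto simp: is_word_def intro!: exI[of _ "drop i (take j xs)"])
  qed
  have \<gamma>0: "\<gamma> 0 = 0" and \<gamma>L: "\<gamma> (len g) = g"
    using xs by (simp_all add: \<gamma>_def)
  have le: "dst (\<gamma> i) (\<gamma> j) \<le> j - i" if "i \<le> j" "j \<le> len g" for i j
    using word[OF that] by (auto simp: dst_def intro: len_le)
  \<comment> \<open>The three bounds \<open>le\<close> along 0, \<open>\<gamma> i\<close>,
    \<open>\<gamma> j\<close>, g add up to \<open>len g\<close>, so none of them can be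
    strict.\<close>
  have eq: "dst (\<gamma> i) (\<gamma> j) = j - i" if "i \<le> j" "j \<le> len g" for i j
  proof -
    have "len g \<le> dst 0 (\<gamma> i) + dst (\<gamma> i) (\<gamma> j) + dst (\<gamma> j) g"
      using dst_triangle[of 0 g "\<gamma> i"] dst_triangle[of "\<gamma> i" g "\<gamma> j"] by simp
    then show ?thesis
      using le[of 0 i] le[of i j] le[of j "len g"] that \<gamma>0 \<gamma>L by simp
  qed
  show ?thesis
    using that[of \<gamma>] eq eq[of 0] eq[of _ "len g"] \<gamma>0 \<gamma>L by simp
qed

end

section \<open>Frink chains\<close>

text \<open>The chain is cut where half of its total length is reached: by induction both pieces, and trivially
  the link between them, contribute at most the total.\<close>

lemma frink_chain:
  fixes \<rho> :: "'a \<Rightarrow> 'a \<Rightarrow> real"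
  assumes nonneg: "\<And>x y. 0 \<le> \<rho> x y"
    and quasi: "\<And>x y z. \<rho> x z \<le> K * max (\<rho> x y) (\<rho> y z)"
    and K: "1 \<le> K" "K\<^sup>2 \<le> 2"
    and "a < b"
  shows "\<rho> (x a) (x b) \<le> 2 * (\<Sum>i=a..<b. \<rho> (x i) (x (Suc i)))"
  using \<open>a < b\<close>
proof (induction "b - a" arbitrary: a b rule: less_induct)
  case less
  define T where "T c d = (\<Sum>i=c..<d. \<rho> (x i) (x (Suc i)))" for c d
  have T_split: "T c d = T c m + T m d" if "c \<le> m" "m \<le> d" for c m d
    unfolding T_def using that by (simp add: sum.atLeastLessThan_concat)
  have T_nonneg: "0 \<le> T c d" for c d
    unfolding T_def by (simp add: nonneg sum_nonneg)
  have T_Suc: "T m (Suc m) = \<rho> (x m) (x (Suc m))" for m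
    by (simp add: T_def)
  define m where "m = (GREATEST m. a \<le> m \<and> m < b \<and> T a m \<le> T a b / 2)"
  have ex: "a \<le> a \<and> a < b \<and> T a a \<le> T a b / 2"
    using less.prems T_nonneg[of a b] by (simp add: T_def)
  have m: "a \<le> m" "m < b" "T a m \<le> T a b / 2"
    using GreatestI_nat[where P = "\<lambda>m. a \<le> m \<and> m < b \<and> T a m \<le> T a b / 2" and k = a and b = b, OF ex]
    unfolding m_def by auto
  have m_max: "T (Suc m) b \<le> T a b / 2"
  proof (cases "Suc m < b")
    case True
    have "\<not> (T a (Suc m) \<le> T a b / 2)"
      using Greatest_le_nat[where P = "\<lambda>m. a \<le> m \<and> m < b \<and> T a m \<le> T a b / 2" and k = "Suc m" and b = b]
        True m unfolding m_def[symmetric] by fastforce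
    then show ?thesis
      using T_split[of a "Suc m" b] True m by simp
  next
    case False
    then show ?thesis using T_nonneg[of a b] by (simp add: T_def)
  qed
  \<comment> \<open>An empty piece needs its own branch because \<rho> is not assumed to vanish on
    the diagonal; in the application \<open>\<rho> x x\<close> is exp (- \<epsilon> * len x) >
    0.\<close>
  have left: "a = m \<or> \<rho> (x a) (x m) \<le> T a b"
    using less.hyps[of m a] m unfolding T_def[symmetric] by fastforce
  have mid: "\<rho> (x m) (x (Suc m)) \<le> T a b"
    using T_split[of a m b] T_split[of m "Suc m" b] T_Suc[of m] T_nonneg[of a m] T_nonneg[of "Suc m" b] m
    by simp
  have right: "Suc m = b \<or> \<rho> (x (Suc m)) (x b) \<le> T a b"
    using less.hyps[of b "Suc m"] m m_max unfolding T_def[symmetric] by fastforce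
  have one: "T a b \<le> K * T a b"
    using K(1) T_nonneg[of a b] by (simp add: mult_left_le mult_le_cancel_right1)
  have step1: "\<rho> (x m) (x b) \<le> K * T a b"
    using right
  proof
    assume "Suc m = b"
    then show ?thesis using mid one by simp
  next
    assume "\<rho> (x (Suc m)) (x b) \<le> T a b"
    then have "max (\<rho> (x m) (x (Suc m))) (\<rho> (x (Suc m)) (x b)) \<le> T a b" using mid by simp
    then show ?thesis
      using quasi[of "x m" "x b" "x (Suc m)"] K(1) by (meson mult_left_mono order_trans zero_le_one)
  qed
  \<comment> \<open>Joining three pieces takes two uses of \<open>quasi\<close>, hence the factor
    \<open>K\<^sup>2\<close>, which must not exceed 2 for the induction to close.\<close>
  have "\<rho> (x a) (x b) \<le> K * (K * T a b)"
    using left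
  proof
    assume "a = m"
    moreover have "K * T a b \<le> K * (K * T a b)"
      using one K(1) by (simp add: mult_left_mono)
    ultimately show ?thesis using step1 by simp
  next
    assume "\<rho> (x a) (x m) \<le> T a b"
    then have "max (\<rho> (x a) (x m)) (\<rho> (x m) (x b)) \<le> K * T a b" using step1 one by simp
    then show ?thesis
      using quasi[of "x a" "x b" "x m"] K(1) by (meson mult_left_mono order_trans zero_le_one)
  qed
  also have "\<dots> = K\<^sup>2 * T a b" by (simp add: power2_eq_square)
  also have "\<dots> \<le> 2 * T a b" using K(2) T_nonneg[of a b] by (rule mult_right_mono)
  finally show ?case by (simp add: T_def)
qed

text \<open>\<open>\<rho>\<close> satisfies only a quasi-triangle inequality, so
  \<open>\<rho> x z\<close> is replaced by the infimum of the costs of chains from x to z.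
  Prepending a link bounds the increments, and \<open>frink_chain\<close> keeps the infimum
  comparable to \<open>\<rho> x z\<close>.\<close>

lemma frink_lipschitz_function:
  fixes \<rho> :: "'a \<Rightarrow> 'a \<Rightarrow> real"
  assumes nonneg: "\<And>x y. 0 \<le> \<rho> x y"
    and sym: "\<And>x y. \<rho> x y = \<rho> y x"
    and quasi: "\<And>x y z. \<rho> x z \<le> K * max (\<rho> x y) (\<rho> y z)"
    and K: "1 \<le> K" "K\<^sup>2 \<le> 2"
  obtains f where "\<And>x y. \<bar>f x - f y\<bar> \<le> \<rho> x y" "\<And>x. f x \<le> \<rho> x z" "\<And>x. \<rho> x z / 2 \<le> f x"
proof -
  \<comment> \<open>\<open>n > 0\<close> excludes the empty chain, which at u = z would give the sum
    0 and could break the lower bound by \<open>\<rho> z z / 2\<close>.\<close>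
  define A where "A u = {(\<Sum>i<n. \<rho> (x i) (x (Suc i))) | n x. n > 0 \<and> x 0 = u \<and> x n = z}" for u
  define f where "f u = Inf (A u)" for u
  have direct: "\<rho> u z \<in> A u" for u
    unfolding A_def
    by (rule CollectI, rule exI[of _ 1], rule exI[of _ "\<lambda>i. if i = 0 then u else z"]) simp
  have lower: "\<rho> u z / 2 \<le> s" if "s \<in> A u" for s u
  proof -
    from that obtain n x where "s = (\<Sum>i<n. \<rho> (x i) (x (Suc i)))" "n > 0" "x 0 = u" "x n = z"
      by (auto simp: A_def)
    with frink_chain[of \<rho> K 0 n x, OF nonneg quasi K] show ?thesis
      by (simp add: atLeast0LessThan)
  qed
  then have bdd: "bdd_below (A u)" for u by (rule bdd_belowI)
  have prepend: "\<rho> u v + s \<in> A u" if "s \<in> A v" for s u v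
  proof -
    from that obtain n x where *: "s = (\<Sum>i<n. \<rho> (x i) (x (Suc i)))" "n > 0" "x 0 = v" "x n = z"
      by (auto simp: A_def)
    define y where "y i = (case i of 0 \<Rightarrow> u | Suc j \<Rightarrow> x j)" for i
    have "(\<Sum>i<Suc n. \<rho> (y i) (y (Suc i))) = \<rho> u v + s"
      unfolding sum.lessThan_Suc_shift using * by (simp add: y_def)
    moreover have "y 0 = u" "y (Suc n) = z" using * by (simp_all add: y_def)
    ultimately show ?thesis unfolding A_def
      by (intro CollectI exI[of _ "Suc n"] exI[of _ y]) simp
  qed
  have le: "f u - f v \<le> \<rho> u v" for u v
  proof -
    have "f u - \<rho> u v \<le> s" if "s \<in> A v" for s
      using cInf_lower[OF prepend[OF that] bdd, of u] by (simp add: f_def)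
    then have "f u - \<rho> u v \<le> f v"
      unfolding f_def[of v] using direct by (intro cInf_greatest) auto
    then show ?thesis by simp
  qed
  show ?thesis
  proof (rule that[of f])
    show "\<bar>f x - f y\<bar> \<le> \<rho> x y" for x y
      using le[of x y] le[of y x] sym[of x y] by linarith
    show "f x \<le> \<rho> x z" for x
      unfolding f_def by (rule cInf_lower[OF direct bdd])
    show "\<rho> x z / 2 \<le> f x" for x
      unfolding f_def using direct lower by (intro cInf_greatest) auto
  qed
qed

section \<open>Translation in L_p\<close>

text \<open>A crude substitute for Minkowski's inequality. The factor 2 powr p is harmless where
  only finiteness, smallness or boundedness of p-th powers matters.\<close>

lemma powr_abs_add_le:
  fixes a b p :: real
  assumes "p > 0"
  shows "\<bar>a + b\<bar> powr p \<le> 2 powr p * (\<bar>a\<bar> powr p + \<bar>b\<bar> powr p)"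
proof -
  have "\<bar>a + b\<bar> powr p \<le> (2 * max \<bar>a\<bar> \<bar>b\<bar>) powr p"
    using assms by (intro powr_mono2) auto
  also have "\<dots> = 2 powr p * max \<bar>a\<bar> \<bar>b\<bar> powr p"
    by (simp add: powr_mult)
  also have "\<dots> \<le> 2 powr p * (\<bar>a\<bar> powr p + \<bar>b\<bar> powr p)"
    by (intro mult_left_mono) (auto simp: max_def)
  finally show ?thesis .
qed

section \<open>Right Haar measure and p-th powers of L_p norms\<close>

locale right_haar =
  fixes M :: "'g::{topological_group_add,t2_space} measure"
  assumes haar: "right_haar_measure M"
begin

lemmas haar_conds = haar[unfolded right_haar_measure_def]

lemma sets_M [measurable_cong]: "sets M = sets borel"
  by (rule haar_conds[THEN conjunct1])

lemma space_M [simp]: "space M = UNIV"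
  using sets_eq_imp_space_eq[OF sets_M] by simp

lemma translate_measurable [measurable]: "(\<lambda>x. x + g) \<in> measurable M M"
proof -
  have "(\<lambda>x. x + g) \<in> measurable borel (borel :: 'g measure)"
    by (intro borel_measurable_continuous_onI continuous_intros)
  then show ?thesis by (simp add: measurable_cong_sets[OF sets_M sets_M])
qed

lemma emeasure_compact: "compact K \<Longrightarrow> emeasure M K < \<infinity>"
  by (rule haar_conds[THEN conjunct2, THEN conjunct2, THEN conjunct1, rule_format])

lemma emeasure_open_pos: "open U \<Longrightarrow> U \<noteq> {} \<Longrightarrow> emeasure M U > 0"
  by (rule haar_conds[THEN conjunct2, THEN conjunct2, THEN conjunct2, THEN conjunct1, rule_format])

lemma open_in_sets [measurable]: "open U \<Longrightarrow> U \<in> sets M"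
  by (simp add: sets_M)

lemma compact_in_sets: "compact K \<Longrightarrow> K \<in> sets M"
  by (simp add: sets_M compact_imp_closed)

lemma emeasure_translate_image: "A \<in> sets M \<Longrightarrow> emeasure M ((\<lambda>x. x + g) ` A) = emeasure M A"
  by (rule haar_conds[THEN conjunct2, THEN conjunct1, rule_format])

lemma vimage_translate: "{x. x + g \<in> A} = (\<lambda>x. x + - g) ` (A :: 'g set)"
proof (intro set_eqI iffI)
  fix x assume "x \<in> {x. x + g \<in> A}"
  then show "x \<in> (\<lambda>x. x + - g) ` A"
    by (intro image_eqI[of _ _ "x + g"]) (auto simp: add.assoc)
next
  fix x assume "x \<in> (\<lambda>x. x + - g) ` A"
  then show "x \<in> {x. x + g \<in> A}" by (auto simp: add.assoc)
qed

lemma emeasure_translate: "A \<in> sets M \<Longrightarrow> emeasure M {x. x + g \<in> A} = emeasure M A"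
  by (subst vimage_translate) (rule emeasure_translate_image)

lemma translate_in_sets: "A \<in> sets M \<Longrightarrow> {x. x + g \<in> A} \<in> sets M"
  using measurable_sets[OF translate_measurable] by (simp add: vimage_def)

lemma distr_translate: "distr M M (\<lambda>x. x + g) = M"
proof (rule measure_eqI)
  fix A assume "A \<in> sets (distr M M (\<lambda>x. x + g))"
  then have "A \<in> sets M" by simp
  then show "emeasure (distr M M (\<lambda>x. x + g)) A = emeasure M A"
    using emeasure_translate by (simp add: emeasure_distr vimage_def)
qed simp

lemma nn_integral_translate:
  assumes [measurable]: "f \<in> borel_measurable M"
  shows "(\<integral>\<^sup>+x. f (x + g) \<partial>M) = (\<integral>\<^sup>+x. f x \<partial>M)"
  using nn_integral_distr[OF translate_measurable, of f g] by (simp add: distr_translate)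

text \<open>The p-th power of the L_p norm. Values in ennreal let sums and translates be handled
  before integrability is known.\<close>

definition pnorm :: "real \<Rightarrow> ('g \<Rightarrow> real) \<Rightarrow> ennreal" where
  "pnorm p u = (\<integral>\<^sup>+x. ennreal (\<bar>u x\<bar> powr p) \<partial>M)"

lemma pnorm_mono: "p > 0 \<Longrightarrow> (\<And>x. \<bar>u x\<bar> \<le> \<bar>v x\<bar>) \<Longrightarrow> pnorm p u \<le> pnorm p v"
  unfolding pnorm_def by (intro nn_integral_mono ennreal_leI powr_mono2) auto

lemma pnorm_minus: "pnorm p (\<lambda>x. u x - v x) = pnorm p (\<lambda>x. v x - u x)"
  by (simp add: pnorm_def abs_minus_commute)

lemma pnorm_cmult:
  assumes [measurable]: "u \<in> borel_measurable M"
  shows "pnorm p (\<lambda>x. a * u x) = ennreal (\<bar>a\<bar> powr p) * pnorm p u"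
  unfolding pnorm_def by (simp add: nn_integral_cmult[symmetric] abs_mult powr_mult ennreal_mult)

lemma pnorm_add_le:
  assumes [measurable]: "u \<in> borel_measurable M" "v \<in> borel_measurable M" and "p > 0"
  shows "pnorm p (\<lambda>x. u x + v x) \<le> ennreal (2 powr p) * (pnorm p u + pnorm p v)"
proof -
  have "pnorm p (\<lambda>x. u x + v x) \<le> (\<integral>\<^sup>+x. ennreal (2 powr p) * (ennreal (\<bar>u x\<bar> powr p) + ennreal (\<bar>v x\<bar> powr p)) \<partial>M)"
    unfolding pnorm_def
    using powr_abs_add_le[OF \<open>p > 0\<close>]
    by (intro nn_integral_mono) (simp add: ennreal_plus[symmetric] ennreal_mult[symmetric] del: ennreal_plus)
  also have "\<dots> = ennreal (2 powr p) * (pnorm p u + pnorm p v)"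
    unfolding pnorm_def by (simp add: nn_integral_cmult nn_integral_add)
  finally show ?thesis .
qed

lemma pnorm_translate:
  assumes [measurable]: "u \<in> borel_measurable M"
  shows "pnorm p (\<lambda>x. u (x + g)) = pnorm p u"
  unfolding pnorm_def
  by (rule nn_integral_translate[where f = "\<lambda>x. ennreal (\<bar>u x\<bar> powr p)"]) measurable

lemma pnorm_indicator:
  assumes "A \<in> sets M"
  shows "pnorm p (indicator A) = emeasure M A"
proof -
  have "pnorm p (indicator A) = (\<integral>\<^sup>+x. indicator A x \<partial>M)"
    unfolding pnorm_def by (intro nn_integral_cong) (simp add: indicator_def)
  then show ?thesis using assms by simp
qed

text \<open>Continuity at 0 of the orbit of w under right translation. Only differences are
  measured, so w may lie outside L_p; this covers the vectors and the bounded potentials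
  alike.\<close>

definition tcont :: "real \<Rightarrow> ('g \<Rightarrow> real) \<Rightarrow> bool" where
  "tcont p w \<longleftrightarrow> w \<in> borel_measurable M \<and>
     (\<forall>\<eta>>0. \<exists>U. open U \<and> 0 \<in> U \<and> (\<forall>u\<in>U. pnorm p (\<lambda>x. w (x + u) - w x) \<le> ennreal \<eta>))"

lemma tcont_measurable: "tcont p w \<Longrightarrow> w \<in> borel_measurable M"
  by (simp add: tcont_def)

lemma tcontD:
  assumes "tcont p w" "\<eta> > 0"
  obtains U where "open U" "0 \<in> U" "\<And>u. u \<in> U \<Longrightarrow> pnorm p (\<lambda>x. w (x + u) - w x) \<le> ennreal \<eta>"
  using assms by (auto simp: tcont_def)

lemma tcont_add:
  assumes p: "p > 0" and v: "tcont p v" and w: "tcont p w"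
  shows "tcont p (\<lambda>x. v x + w x)"
  unfolding tcont_def
proof (intro conjI allI impI)
  note [measurable] = tcont_measurable[OF v] tcont_measurable[OF w]
  show "(\<lambda>x. v x + w x) \<in> borel_measurable M" by measurable
  fix \<eta> :: real assume "\<eta> > 0"
  define \<eta>' where "\<eta>' = \<eta> / (2 * 2 powr p)"
  have \<eta>': "\<eta>' > 0" using \<open>\<eta> > 0\<close> by (simp add: \<eta>'_def)
  obtain U where U: "open U" "0 \<in> U" "\<And>u. u \<in> U \<Longrightarrow> pnorm p (\<lambda>x. v (x + u) - v x) \<le> ennreal \<eta>'"
    using tcontD[OF v \<eta>'] by blast
  obtain W where W: "open W" "0 \<in> W" "\<And>u. u \<in> W \<Longrightarrow> pnorm p (\<lambda>x. w (x + u) - w x) \<le> ennreal \<eta>'"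
    using tcontD[OF w \<eta>'] by blast
  have "pnorm p (\<lambda>x. v (x + u) + w (x + u) - (v x + w x)) \<le> ennreal \<eta>" if "u \<in> U \<inter> W" for u
  proof -
    have "pnorm p (\<lambda>x. v (x + u) + w (x + u) - (v x + w x)) =
        pnorm p (\<lambda>x. (v (x + u) - v x) + (w (x + u) - w x))"
      by (simp add: algebra_simps)
    also have "\<dots> \<le> ennreal (2 powr p) * (pnorm p (\<lambda>x. v (x + u) - v x) + pnorm p (\<lambda>x. w (x + u) - w x))"
      using p by (intro pnorm_add_le) measurable
    also have "\<dots> \<le> ennreal (2 powr p) * (ennreal \<eta>' + ennreal \<eta>')"
      using U(3) W(3) that by (intro mult_left_mono add_mono) auto
    also have "\<dots> = ennreal \<eta>"
      using \<eta>' by (simp add: ennreal_plus[symmetric] ennreal_mult[symmetric] \<eta>'_def del: ennreal_plus)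
    finally show ?thesis .
  qed
  then show "\<exists>U. open U \<and> 0 \<in> U \<and>
      (\<forall>u\<in>U. pnorm p (\<lambda>x. v (x + u) + w (x + u) - (v x + w x)) \<le> ennreal \<eta>)"
    using U W by (intro exI[of _ "U \<inter> W"]) auto
qed

lemma tcont_zero: "tcont p (\<lambda>x. 0)"
  by (auto simp: tcont_def pnorm_def intro!: exI[of _ UNIV])

lemma tcont_sum:
  assumes "p > 0" "finite I" "\<And>i. i \<in> I \<Longrightarrow> tcont p (w i)"
  shows "tcont p (\<lambda>x. \<Sum>i\<in>I. w i x)"
  using assms(2,3) by (induction I rule: finite_induct) (auto intro: tcont_zero tcont_add[OF \<open>p > 0\<close>])

lemma tcont_cmult:
  assumes w: "tcont p w"
  shows "tcont p (\<lambda>x. a * w x)"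
  unfolding tcont_def
proof (intro conjI allI impI)
  note [measurable] = tcont_measurable[OF w]
  show "(\<lambda>x. a * w x) \<in> borel_measurable M" by measurable
  fix \<eta> :: real assume "\<eta> > 0"
  \<comment> \<open>The summand 1 in the denominator covers a = 0.\<close>
  define \<eta>' where "\<eta>' = \<eta> / (\<bar>a\<bar> powr p + 1)"
  have \<eta>': "\<eta>' > 0" unfolding \<eta>'_def
    using \<open>\<eta> > 0\<close> by (intro divide_pos_pos add_nonneg_pos) auto
  obtain U where U: "open U" "0 \<in> U" "\<And>u. u \<in> U \<Longrightarrow> pnorm p (\<lambda>x. w (x + u) - w x) \<le> ennreal \<eta>'"
    using tcontD[OF w \<eta>'] by blast
  have "pnorm p (\<lambda>x. a * w (x + u) - a * w x) \<le> ennreal \<eta>" if "u \<in> U" for u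
  proof -
    have "pnorm p (\<lambda>x. a * w (x + u) - a * w x) = ennreal (\<bar>a\<bar> powr p) * pnorm p (\<lambda>x. w (x + u) - w x)"
      by (subst pnorm_cmult[symmetric]) (simp_all add: right_diff_distrib)
    also have "\<dots> \<le> ennreal (\<bar>a\<bar> powr p + 1) * ennreal \<eta>'"
      using U(3)[OF that] by (intro mult_mono ennreal_leI) auto
    also have "\<dots> = ennreal ((\<bar>a\<bar> powr p + 1) * \<eta>')"
      using \<eta>' by (subst ennreal_mult) auto
    also have "(\<bar>a\<bar> powr p + 1) * \<eta>' = \<eta>"
      unfolding \<eta>'_def using add_nonneg_pos[OF powr_ge_zero[of "\<bar>a\<bar>" p] zero_less_one] by simp
    finally show ?thesis .
  qed
  then show "\<exists>U. open U \<and> 0 \<in> U \<and>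
      (\<forall>u\<in>U. pnorm p (\<lambda>x. a * w (x + u) - a * w x) \<le> ennreal \<eta>)"
    using U by blast
qed

text \<open>Pass from the translate of v to that of w, then to w, then back to v. By right
  invariance the first step costs as much as the last, so only the middle one depends on u.\<close>

lemma tcont_approx:
  assumes p: "p > 0" and v[measurable]: "v \<in> borel_measurable M"
    and approx: "\<And>\<eta>. \<eta> > 0 \<Longrightarrow> \<exists>w. tcont p w \<and> pnorm p (\<lambda>x. v x - w x) \<le> ennreal \<eta>"
  shows "tcont p v"
  unfolding tcont_def
proof (intro conjI allI impI v)
  fix \<eta> :: real assume "\<eta> > 0"
  define c where "c = (2::real) powr p"
  \<comment> \<open>Three differences are split by two nested uses of \<open>pnorm_add_le\<close>,
    at total cost c * (1 + 2 * c).\<close>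
  define \<eta>' where "\<eta>' = \<eta> / (c * (1 + 2 * c))"
  have c: "c > 0" by (simp add: c_def)
  have \<eta>': "\<eta>' > 0" unfolding \<eta>'_def using \<open>\<eta> > 0\<close> c
    by (intro divide_pos_pos mult_pos_pos add_pos_pos) auto
  obtain w where w: "tcont p w" "pnorm p (\<lambda>x. v x - w x) \<le> ennreal \<eta>'"
    using approx[OF \<eta>'] by blast
  note [measurable] = tcont_measurable[OF w(1)]
  obtain U where U: "open U" "0 \<in> U" "\<And>u. u \<in> U \<Longrightarrow> pnorm p (\<lambda>x. w (x + u) - w x) \<le> ennreal \<eta>'"
    using tcontD[OF w(1) \<eta>'] by blast
  have "pnorm p (\<lambda>x. v (x + u) - v x) \<le> ennreal \<eta>" if "u \<in> U" for u
  proof -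
    have *: "pnorm p (\<lambda>x. (w (x + u) - w x) + (w x - v x)) \<le> ennreal c * (ennreal \<eta>' + ennreal \<eta>')"
      unfolding c_def
      using p w(2) U(3)[OF that] pnorm_minus[of p w v]
      by (intro order_trans[OF pnorm_add_le] mult_left_mono add_mono) auto
    have tr: "pnorm p (\<lambda>x. v (x + u) - w (x + u)) = pnorm p (\<lambda>x. v x - w x)"
      by (rule pnorm_translate[where u = "\<lambda>x. v x - w x"]) measurable
    have "pnorm p (\<lambda>x. v (x + u) - v x) =
        pnorm p (\<lambda>x. (v (x + u) - w (x + u)) + ((w (x + u) - w x) + (w x - v x)))"
      by (simp add: algebra_simps)
    also have "\<dots> \<le> ennreal c * (pnorm p (\<lambda>x. v (x + u) - w (x + u)) + pnorm p (\<lambda>x. (w (x + u) - w x) + (w x - v x)))"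
      unfolding c_def using p by (intro pnorm_add_le) measurable
    also have "\<dots> \<le> ennreal c * (ennreal \<eta>' + ennreal c * (ennreal \<eta>' + ennreal \<eta>'))"
      using w(2) * tr by (intro mult_left_mono add_mono) auto
    also have "\<dots> = ennreal (c * (\<eta>' + c * (\<eta>' + \<eta>')))"
      using c \<eta>' by (simp only: ennreal_mult ennreal_plus add_nonneg_nonneg mult_nonneg_nonneg less_imp_le)
    also have "c * (\<eta>' + c * (\<eta>' + \<eta>')) = c * (1 + 2 * c) * \<eta>'"
      by (simp add: algebra_simps)
    also have "\<dots> = \<eta>"
      unfolding \<eta>'_def using c by simp
    finally show ?thesis .
  qed
  then show "\<exists>U. open U \<and> 0 \<in> U \<and> (\<forall>u\<in>U. pnorm p (\<lambda>x. v (x + u) - v x) \<le> ennreal \<eta>)"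
    using U by blast
qed

text \<open>Tube lemma around \<open>{0} \<times> K\<close>. Both signs are provided because an
  indicator can change between x and x + u in two ways, by leaving the set or by entering
  it.\<close>

lemma compact_add_nhd:
  assumes "compact K" "open U" "K \<subseteq> (U :: 'g set)"
  obtains V where "open V" "0 \<in> V" "\<And>k v. k \<in> K \<Longrightarrow> v \<in> V \<Longrightarrow> k + v \<in> U \<and> k - v \<in> U"
proof -
  define W where "W = (\<lambda>z::'g \<times> 'g. snd z + fst z) -` U \<inter> (\<lambda>z. snd z - fst z) -` U"
  have "open W" unfolding W_def
    by (intro open_Int open_vimage \<open>open U\<close> continuous_intros)
  moreover have "{0} \<times> K \<subseteq> W" using assms by (auto simp: W_def)
  ultimately have "\<exists>V. 0 \<in> V \<and> open V \<and> V \<times> K \<subseteq> W"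
    by (rule Elementary_Topology.tube_lemma[OF \<open>compact K\<close>])
  then obtain V where "0 \<in> V" "open V" "V \<times> K \<subseteq> W" by (elim exE conjE)
  moreover from this have "(v, k) \<in> W" if "k \<in> K" "v \<in> V" for k v
    using that by auto
  ultimately show ?thesis using that[of V] by (simp add: W_def)
qed

text \<open>Inner regularity is available for open sets, so K approximates U from inside rather than
  A, and need not be contained in A.\<close>

lemma regular_approx:
  assumes A: "A \<in> sets M" "emeasure M A < \<infinity>" and \<eta>: "(\<eta>::real) > 0"
  obtains K U where "compact K" "open U" "K \<subseteq> U" "A \<subseteq> U"
    "emeasure M (U - A) \<le> \<eta>" "emeasure M (U - K) \<le> \<eta>"
proof -
  have outer: "emeasure M A = (INF U\<in>{U. open U \<and> A \<subseteq> U}. emeasure M U)"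
    by (rule haar_conds[THEN conjunct2, THEN conjunct2, THEN conjunct2, THEN conjunct2, THEN conjunct1,
          rule_format]) (rule A(1))
  have "\<exists>U\<in>{U. open U \<and> A \<subseteq> U}. emeasure M U < emeasure M A + ennreal \<eta>"
    using A \<eta> by (intro INF_approx_ennreal[OF _ outer]) auto
  then obtain U where U: "open U" "A \<subseteq> U" "emeasure M U < emeasure M A + ennreal \<eta>" by auto
  have "emeasure M A + ennreal \<eta> < \<infinity>" using A(2) by simp
  with U(3) have fin: "emeasure M U < \<infinity>" by (rule less_trans)
  have inner: "emeasure M U = (SUP K\<in>{K. compact K \<and> K \<subseteq> U}. emeasure M K)"
    by (rule haar_conds[THEN conjunct2, THEN conjunct2, THEN conjunct2, THEN conjunct2, THEN conjunct2,
          rule_format]) (rule U(1))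
  have "\<exists>K\<in>{K. compact K \<and> K \<subseteq> U}. emeasure M U < emeasure M K + ennreal \<eta>"
    using fin \<eta> by (intro SUP_approx_ennreal[OF _ _ inner]) (auto intro: exI[of _ "{}"])
  then obtain K where K: "compact K" "K \<subseteq> U" "emeasure M U < emeasure M K + ennreal \<eta>" by auto
  have diff: "emeasure M (U - B) \<le> ennreal \<eta>"
    if "B \<in> sets M" "B \<subseteq> U" "emeasure M U < emeasure M B + ennreal \<eta>" for B
  proof -
    have "emeasure M B \<le> emeasure M U"
      using that(2) U(1) by (intro emeasure_mono open_in_sets)
    then have "emeasure M B \<noteq> \<infinity>" using fin by auto
    moreover have "emeasure M B + emeasure M (U - B) = emeasure M U"
      using plus_emeasure[of B M "U - B"] that(1,2) U(1) by (simp add: open_in_sets sets.Diff Un_absorb1)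
    then have "emeasure M B + emeasure M (U - B) \<le> emeasure M B + ennreal \<eta>"
      using that(3) by simp
    ultimately show ?thesis by (simp add: ennreal_add_left_cancel_le)
  qed
  show ?thesis
    using that[OF K(1) U(1) K(2) U(2) diff[OF A(1) U(2,3)] diff[OF compact_in_sets[OF K(1)] K(2,3)]] .
qed

lemma tcont_indicator:
  assumes A[measurable]: "A \<in> sets M" "emeasure M A < \<infinity>"
  shows "tcont p (indicator A)"
  unfolding tcont_def
proof (intro conjI allI impI)
  show "indicator A \<in> borel_measurable M" by measurable
  fix \<eta> :: real assume "\<eta> > 0"
  then have "\<eta> / 4 > 0" by simp
  then obtain K U where KU: "compact K" "open U" "K \<subseteq> U" "A \<subseteq> U"
    "emeasure M (U - A) \<le> ennreal (\<eta> / 4)" "emeasure M (U - K) \<le> ennreal (\<eta> / 4)"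
    by (rule regular_approx[OF A])
  obtain V where V: "open V" "0 \<in> V" "\<And>k v. k \<in> K \<Longrightarrow> v \<in> V \<Longrightarrow> k + v \<in> U \<and> k - v \<in> U"
    using compact_add_nhd[OF KU(1-3)] by blast
  have [measurable]: "U \<in> sets M" "K \<in> sets M"
    using KU by (auto simp: open_in_sets compact_in_sets)
  have "pnorm p (\<lambda>x. indicator A (x + u) - indicator A x) \<le> ennreal \<eta>" if "u \<in> V" for u
  proof -
    \<comment> \<open>If x is in A and x + u is not, then either x is in U - K or, since V moves K
      within U, x + u is in U - A; the other case is symmetric. This makes four sets, each of
      measure at most \<eta> / 4.\<close>
    define D where "D = {x. x + u \<in> U - A} \<union> (U - A) \<union> ((U - K) \<union> {x. x + u \<in> U - K})"
    have sets: "{x. x + u \<in> U - A} \<in> sets M" "{x. x + u \<in> U - K} \<in> sets M"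
      by (rule translate_in_sets; measurable)+
    have D: "D \<in> sets M" unfolding D_def using sets by auto
    have mem: "x \<in> D" if "(x \<in> A) \<noteq> (x + u \<in> A)" for x
    proof (cases "x \<in> A")
      case True
      then show ?thesis using that KU(4) V(3)[of x u] \<open>u \<in> V\<close> by (auto simp: D_def)
    next
      case False
      have "x + u - u = x" by (simp add: add.assoc diff_conv_add_uminus del: add_uminus_conv_diff)
      then show ?thesis using that False KU(4) V(3)[of "x + u" u] \<open>u \<in> V\<close> by (auto simp: D_def)
    qed
    have "pnorm p (\<lambda>x. indicator A (x + u) - indicator A x) \<le> (\<integral>\<^sup>+x. indicator D x \<partial>M)"
      unfolding pnorm_def
    proof (intro nn_integral_mono)
      fix x
      show "ennreal (\<bar>indicator A (x + u) - indicator A x\<bar> powr p) \<le> indicator D x"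
        using mem[of x] by (auto simp: indicator_def)
    qed
    also have "\<dots> = emeasure M D" using D by simp
    also have "\<dots> \<le> (emeasure M {x. x + u \<in> U - A} + emeasure M (U - A)) +
        (emeasure M (U - K) + emeasure M {x. x + u \<in> U - K})"
      unfolding D_def using sets
      by (intro order_trans[OF emeasure_subadditive] add_mono order.refl) auto
    also have "\<dots> \<le> (ennreal (\<eta> / 4) + ennreal (\<eta> / 4)) + (ennreal (\<eta> / 4) + ennreal (\<eta> / 4))"
      using KU(5,6) emeasure_translate[of "U - A" u] emeasure_translate[of "U - K" u]
      by (intro add_mono) auto
    also have "\<dots> = ennreal \<eta>"
      using \<open>\<eta> > 0\<close> by (simp add: ennreal_plus[symmetric] del: ennreal_plus)
    finally show ?thesis .
  qed
  then show "\<exists>U. open U \<and> 0 \<in> U \<and>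
      (\<forall>u\<in>U. pnorm p (\<lambda>x. indicator A (x + u) - indicator A x) \<le> ennreal \<eta>)"
    using V by blast
qed

lemma tcont_simple:
  assumes p: "p > 0" and s: "simple_function M s" and fin: "pnorm p s < \<infinity>"
  shows "tcont p s"
proof -
  have [measurable]: "s \<in> borel_measurable M" using s by (rule borel_measurable_simple_function)
  have "finite (range s)" using simple_functionD(1)[OF s] by simp
  have "tcont p (\<lambda>x. y * indicator (s -` {y}) x)" for y
  \<comment> \<open>The zero level set may have infinite measure, but its term vanishes.\<close>
  proof (cases "y = 0")
    case True
    then show ?thesis by (simp add: tcont_zero)
  next
    case False
    have A: "s -` {y} \<in> sets M" using simple_functionD(2)[OF s, of "{y}"] by simp
    have "ennreal (\<bar>y\<bar> powr p) * emeasure M (s -` {y}) =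
        (\<integral>\<^sup>+x. ennreal (\<bar>y\<bar> powr p) * indicator (s -` {y}) x \<partial>M)"
      using A by (simp add: nn_integral_cmult_indicator)
    also have "\<dots> \<le> pnorm p s"
      unfolding pnorm_def by (intro nn_integral_mono) (auto simp: indicator_def)
    finally have "ennreal (\<bar>y\<bar> powr p) * emeasure M (s -` {y}) < \<infinity>"
      using fin by (rule le_less_trans)
    then have "emeasure M (s -` {y}) < \<infinity>"
      using False by (auto simp: ennreal_mult_less_top top_unique)
    then show ?thesis
      by (intro tcont_cmult tcont_indicator A)
  qed
  then have "tcont p (\<lambda>x. \<Sum>y\<in>range s. y * indicator (s -` {y}) x)"
    by (intro tcont_sum p \<open>finite (range s)\<close>)
  moreover have "(\<Sum>y\<in>range s. y * indicator (s -` {y}) x) = s x" for x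
    using simple_function_indicator_representation_banach[OF s, of x]
    by (simp only: space_M UNIV_I Int_UNIV_right real_scaleR_def mult.commute)
  ultimately show ?thesis by simp
qed

text \<open>Strong continuity of the right regular representation, by density of simple
  functions.\<close>

lemma tcont_Lp:
  assumes p: "p > 0" and v[measurable]: "v \<in> borel_measurable M" and fin: "pnorm p v < \<infinity>"
  shows "tcont p v"
proof (rule tcont_approx[OF p v])
  fix \<eta> :: real assume "\<eta> > 0"
  obtain s where s: "\<And>i. simple_function M (s i)" "\<And>x. (\<lambda>i. s i x) \<longlonglongrightarrow> v x"
    "\<And>i x. \<bar>s i x\<bar> \<le> 2 * \<bar>v x\<bar>"
    using borel_measurable_implies_sequence_metric[OF v, of 0] by (auto simp: dist_norm)
  have [measurable]: "s i \<in> borel_measurable M" for i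
    using s(1) by (rule borel_measurable_simple_function)
  have fin3: "pnorm p (\<lambda>x. 3 * v x) < \<infinity>"
    using fin by (simp add: pnorm_cmult ennreal_mult_less_top)
  \<comment> \<open>3 = 1 + 2 comes from the bound on s i by twice v; the same majorant puts each s
    i into L_p.\<close>
  have bound: "\<bar>v x - s i x\<bar> \<le> \<bar>3 * v x\<bar>" "\<bar>s i x\<bar> \<le> \<bar>3 * v x\<bar>" for i x
    using s(3)[of i x] by linarith+
  have "(\<lambda>i. \<integral>\<^sup>+x. ennreal (\<bar>v x - s i x\<bar> powr p) \<partial>M) \<longlonglongrightarrow> (\<integral>\<^sup>+x. 0 \<partial>M)"
  proof (rule nn_integral_dominated_convergence[where w = "\<lambda>x. ennreal (\<bar>3 * v x\<bar> powr p)"])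
    show "AE x in M. ennreal (\<bar>v x - s i x\<bar> powr p) \<le> ennreal (\<bar>3 * v x\<bar> powr p)" for i
      using bound p by (intro AE_I2 ennreal_leI powr_mono2) auto
    show "(\<integral>\<^sup>+x. ennreal (\<bar>3 * v x\<bar> powr p) \<partial>M) < \<infinity>"
      using fin3 by (simp add: pnorm_def)
    have "(\<lambda>i. ennreal (\<bar>v x - s i x\<bar> powr p)) \<longlonglongrightarrow> ennreal (\<bar>v x - v x\<bar> powr p)" for x
      using p by (intro tendsto_ennrealI tendsto_powr' tendsto_rabs tendsto_diff tendsto_const s(2)) auto
    then show "AE x in M. (\<lambda>i. ennreal (\<bar>v x - s i x\<bar> powr p)) \<longlonglongrightarrow> 0" by simp
  qed measurable
  then have "(\<lambda>i. pnorm p (\<lambda>x. v x - s i x)) \<longlonglongrightarrow> 0"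
    by (simp add: pnorm_def)
  then have "eventually (\<lambda>i. pnorm p (\<lambda>x. v x - s i x) < ennreal \<eta>) sequentially"
    using \<open>\<eta> > 0\<close> by (intro order_tendstoD) auto
  then obtain i where "pnorm p (\<lambda>x. v x - s i x) < ennreal \<eta>"
    by (auto simp: eventually_sequentially)
  moreover have "pnorm p (s i) < \<infinity>"
    using pnorm_mono[OF p bound(2)] fin3 by (rule le_less_trans)
  ultimately show "\<exists>w. tcont p w \<and> pnorm p (\<lambda>x. v x - w x) \<le> ennreal \<eta>"
    using tcont_simple[OF p s(1)] by (intro exI[of _ "s i"]) auto
qed

subsection \<open>Coboundary actions\<close>

lemma Lp_sum_iff: "v \<in> Lp_sum M p n \<longleftrightarrow> (\<forall>i<n. v i \<in> borel_measurable M \<and> pnorm p (v i) < \<infinity>)"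
proof -
  have "integrable M (\<lambda>x. \<bar>v i x\<bar> powr p) \<longleftrightarrow> pnorm p (v i) < \<infinity>" if [measurable]: "v i \<in> borel_measurable M" for i
    unfolding pnorm_def by (simp add: integrable_iff_bounded)
  then show ?thesis unfolding Lp_sum_def by blast
qed

text \<open>The p-th power of the norm on the l_p-sum; \<open>Lp_dist\<close> is its p-th root,
  taken on differences of finite energy.\<close>

definition penergy :: "real \<Rightarrow> nat \<Rightarrow> (nat \<Rightarrow> 'g \<Rightarrow> real) \<Rightarrow> ennreal" where
  "penergy p n v = (\<Sum>i<n. pnorm p (v i))"

text \<open>Finiteness matters because enn2real sends top to 0 and so need not commute with the sum
  over i.\<close>

lemma Lp_dist_eq:
  assumes "\<And>i. i < n \<Longrightarrow> v i \<in> borel_measurable M" "\<And>i. i < n \<Longrightarrow> w i \<in> borel_measurable M"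
    and fin: "penergy p n (\<lambda>i x. v i x - w i x) < \<infinity>"
  shows "Lp_dist M p n v w = enn2real (penergy p n (\<lambda>i x. v i x - w i x)) powr (1 / p)"
proof -
  have "integral\<^sup>L M (\<lambda>x. \<bar>v i x - w i x\<bar> powr p) = enn2real (pnorm p (\<lambda>x. v i x - w i x))" if "i < n" for i
  proof -
    have [measurable]: "v i \<in> borel_measurable M" "w i \<in> borel_measurable M" using assms that by auto
    show ?thesis unfolding pnorm_def by (intro integral_eq_nn_integral) auto
  qed
  moreover have "pnorm p (\<lambda>x. v i x - w i x) < top" if "i < n" for i
    using fin that by (simp add: penergy_def)
  ultimately show ?thesis
    unfolding Lp_dist_def penergy_def by (subst enn2real_sum) auto
qed

lemma penergy_add_le:
  assumes "p > 0" "\<And>i. i < n \<Longrightarrow> v i \<in> borel_measurable M" "\<And>i. i < n \<Longrightarrow> w i \<in> borel_measurable M"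
  shows "penergy p n (\<lambda>i x. v i x + w i x) \<le> ennreal (2 powr p) * (penergy p n v + penergy p n w)"
  unfolding penergy_def sum.distrib[symmetric] sum_distrib_left
  using assms by (intro sum_mono pnorm_add_le) auto

lemma penergy_finite:
  "(\<And>i. i < n \<Longrightarrow> pnorm p (v i) < \<infinity>) \<Longrightarrow> penergy p n v < \<infinity>"
  by (simp add: penergy_def)

lemma penergy_translate:
  "(\<And>i. i < n \<Longrightarrow> v i \<in> borel_measurable M) \<Longrightarrow> penergy p n (\<lambda>i x. v i (x + g)) = penergy p n v"
  unfolding penergy_def by (intro sum.cong pnorm_translate) auto

lemma powr_le_cancel_root:
  fixes a b p :: real
  assumes "p > 0" "0 \<le> a" "0 \<le> b" "a powr (1 / p) \<le> b"
  shows "a \<le> b powr p"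
  using powr_mono2[of p "a powr (1/p)" b] assms by (simp add: powr_powr)

context
  fixes p :: real and n :: nat and F :: "nat \<Rightarrow> 'g \<Rightarrow> real"
  assumes p: "p > 0"
    and F_fin: "\<And>g i. i < n \<Longrightarrow> pnorm p (\<lambda>x. F i (x + g) - F i x) < \<infinity>"
    and F_tcont: "\<And>i. i < n \<Longrightarrow> tcont p (F i)"
begin

text \<open>The increments of F lie in L_p while F itself is not assumed to, so this is a coboundary
  only formally; the cocycle identity still holds pointwise, by cancellation.\<close>

definition coboundary :: "'g \<Rightarrow> nat \<Rightarrow> 'g \<Rightarrow> real" where
  "coboundary g i x = F i (x + g) - F i x"

lemma F_meas: "i < n \<Longrightarrow> F i \<in> borel_measurable M"
  using F_tcont tcont_measurable by blast

lemma coboundary_meas: "i < n \<Longrightarrow> coboundary g i \<in> borel_measurable M"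
proof -
  assume "i < n"
  note [measurable] = F_meas[OF this]
  show ?thesis unfolding coboundary_def by measurable
qed

lemma coboundary_fin: "i < n \<Longrightarrow> pnorm p (coboundary g i) < \<infinity>"
  using F_fin unfolding coboundary_def .

lemma action_closed:
  assumes v: "v \<in> Lp_sum M p n"
  shows "affine_action coboundary g v \<in> Lp_sum M p n"
  unfolding Lp_sum_iff
proof (intro allI impI conjI)
  fix i assume i: "i < n"
  have [measurable]: "v i \<in> borel_measurable M" and fin: "pnorm p (v i) < \<infinity>"
    using v i by (auto simp: Lp_sum_iff)
  note [measurable] = coboundary_meas[OF i]
  show "affine_action coboundary g v i \<in> borel_measurable M"
    unfolding affine_action_def by measurable
  have "pnorm p (affine_action coboundary g v i) \<le>
      ennreal (2 powr p) * (pnorm p (\<lambda>x. v i (x + g)) + pnorm p (coboundary g i))"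
    unfolding affine_action_def using p by (intro pnorm_add_le) measurable
  also have "\<dots> < \<infinity>"
    using fin coboundary_fin[OF i, of g] pnorm_translate[of "v i" p g] by (simp add: ennreal_mult_less_top)
  finally show "pnorm p (affine_action coboundary g v i) < \<infinity>" .
qed

lemma penergy_diff_fin:
  assumes "v \<in> Lp_sum M p n" "w \<in> Lp_sum M p n"
  shows "penergy p n (\<lambda>i x. v i x - w i x) < \<infinity>"
proof (rule penergy_finite)
  fix i assume i: "i < n"
  have [measurable]: "v i \<in> borel_measurable M" "w i \<in> borel_measurable M"
    and fin: "pnorm p (v i) < \<infinity>" "pnorm p (w i) < \<infinity>"
    using assms i by (auto simp: Lp_sum_iff)
  have "pnorm p (\<lambda>x. v i x + - w i x) \<le> ennreal (2 powr p) * (pnorm p (v i) + pnorm p (\<lambda>x. - w i x))"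
    using p by (intro pnorm_add_le) measurable
  also have "pnorm p (\<lambda>x. - w i x) = pnorm p (w i)" by (simp add: pnorm_def)
  also have "ennreal (2 powr p) * (pnorm p (v i) + pnorm p (w i)) < \<infinity>"
    using fin by (simp add: ennreal_mult_less_top)
  finally show "pnorm p (\<lambda>x. v i x - w i x) < \<infinity>" by simp
qed

lemma Lp_dist_Lp:
  assumes "v \<in> Lp_sum M p n" "w \<in> Lp_sum M p n"
  shows "Lp_dist M p n v w = enn2real (penergy p n (\<lambda>i x. v i x - w i x)) powr (1 / p)"
  using assms penergy_diff_fin[OF assms] by (intro Lp_dist_eq) (auto simp: Lp_sum_iff)

lemma Lp_dist_le_iff:
  assumes "v \<in> Lp_sum M p n" "w \<in> Lp_sum M p n" "0 \<le> r"
  shows "Lp_dist M p n v w \<le> r \<longleftrightarrow> penergy p n (\<lambda>i x. v i x - w i x) \<le> ennreal (r powr p)"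
proof -
  define e where "e = enn2real (penergy p n (\<lambda>i x. v i x - w i x))"
  have E: "penergy p n (\<lambda>i x. v i x - w i x) = ennreal e"
    unfolding e_def using penergy_diff_fin[OF assms(1,2)] by (simp add: less_top)
  have e0: "0 \<le> e" by (simp add: e_def)
  have "e powr (1 / p) \<le> r \<longleftrightarrow> e \<le> r powr p"
  proof
    assume "e powr (1 / p) \<le> r"
    then show "e \<le> r powr p" using p e0 assms(3) by (rule powr_le_cancel_root[rotated -1])
  next
    assume "e \<le> r powr p"
    then have "e powr (1 / p) \<le> (r powr p) powr (1 / p)"
      using p e0 by (intro powr_mono2) auto
    then show "e powr (1 / p) \<le> r" using p assms(3) by (simp add: powr_powr)
  qed
  then show ?thesis
    unfolding Lp_dist_Lp[OF assms(1,2)] E using e0 by simp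
qed

lemma action_isometric:
  assumes v: "v \<in> Lp_sum M p n" and w: "w \<in> Lp_sum M p n"
  shows "Lp_dist M p n (affine_action coboundary g v) (affine_action coboundary g w) = Lp_dist M p n v w"
proof -
  have "penergy p n (\<lambda>i x. affine_action coboundary g v i x - affine_action coboundary g w i x) =
      penergy p n (\<lambda>i x. v i (x + g) - w i (x + g))"
    by (simp add: affine_action_def)
  also have "\<dots> = penergy p n (\<lambda>i x. v i x - w i x)"
    using v w by (intro penergy_translate[where v = "\<lambda>i x. v i x - w i x"] borel_measurable_diff)
      (auto simp: Lp_sum_iff)
  finally show ?thesis
    by (simp add: Lp_dist_Lp v w action_closed)
qed

text \<open>Adding F turns the affine action into pure translation: in the difference of two images
  the term \<open>F i x\<close> cancels, leaving a translate of v - v0 and an increment of v0 +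
  F.\<close>

lemma action_continuous:
  assumes v0: "v0 \<in> Lp_sum M p n" and \<epsilon>: "\<epsilon> > 0"
  shows "\<exists>U \<delta>. open U \<and> g0 \<in> U \<and> \<delta> > 0 \<and>
        (\<forall>g\<in>U. \<forall>v\<in>Lp_sum M p n. Lp_dist M p n v v0 < \<delta> \<longrightarrow>
           Lp_dist M p n (affine_action coboundary g v) (affine_action coboundary g0 v0) < \<epsilon>)"
proof -
  \<comment> \<open>One \<eta> pays for the distance from v to v0 and one for each of the n
    components of w. Aiming at \<epsilon> / 2 yields a strict inequality at the end.\<close>
  define \<eta> where "\<eta> = (\<epsilon> / 2) powr p / (2 powr p * (real n + 1))"
  have \<eta>: "\<eta> > 0" using \<epsilon> by (simp add: \<eta>_def add_nonneg_pos)
  define w where "w i x = v0 i x + F i x" for i x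
  have v0m: "v0 i \<in> borel_measurable M" and v0f: "pnorm p (v0 i) < \<infinity>" if "i < n" for i
    using v0 that by (auto simp: Lp_sum_iff)
  have w: "tcont p (w i)" if "i < n" for i
    unfolding w_def using that by (intro tcont_add p tcont_Lp v0m v0f F_tcont)
  note wm = tcont_measurable[OF w]
  have "\<exists>U. open U \<and> 0 \<in> U \<and> (\<forall>u\<in>U. pnorm p (\<lambda>x. w i (x + u) - w i x) \<le> ennreal \<eta>)" if "i < n" for i
    using w[OF that] \<eta> by (simp add: tcont_def)
  then obtain U where U: "\<And>i. i < n \<Longrightarrow> open (U i)" "\<And>i. i < n \<Longrightarrow> 0 \<in> U i"
    "\<And>i u. i < n \<Longrightarrow> u \<in> U i \<Longrightarrow> pnorm p (\<lambda>x. w i (x + u) - w i x) \<le> ennreal \<eta>"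
    by metis
  \<comment> \<open>Since x + g = (x + g0) + (- g0 + g), right invariance moves the comparison of g
    with g0 to the identity.\<close>
  define V where "V = (\<Inter>i<n. (\<lambda>g. - g0 + g) -` U i)"
  have "open V" unfolding V_def
    by (intro open_INT finite_lessThan ballI open_vimage continuous_intros U) simp
  moreover have "g0 \<in> V" using U(2) by (simp add: V_def)
  moreover have "Lp_dist M p n (affine_action coboundary g v) (affine_action coboundary g0 v0) < \<epsilon>"
    if g: "g \<in> V" and v: "v \<in> Lp_sum M p n" and d: "Lp_dist M p n v v0 < \<eta> powr (1 / p)" for g v
  proof -
    have vm: "v i \<in> borel_measurable M" if "i < n" for i
      using v that by (auto simp: Lp_sum_iff)
    have e1: "penergy p n (\<lambda>i x. v i (x + g) - v0 i (x + g)) \<le> ennreal \<eta>"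
    proof -
      have "penergy p n (\<lambda>i x. v i (x + g) - v0 i (x + g)) = penergy p n (\<lambda>i x. v i x - v0 i x)"
        using vm v0m by (intro penergy_translate[where v = "\<lambda>i x. v i x - v0 i x"] borel_measurable_diff)
      also have "\<dots> \<le> ennreal ((\<eta> powr (1 / p)) powr p)"
        using d Lp_dist_le_iff[OF v v0, of "\<eta> powr (1 / p)"] by simp
      also have "(\<eta> powr (1 / p)) powr p = \<eta>" using p \<eta> by (simp add: powr_powr)
      finally show ?thesis .
    qed
    have e2: "penergy p n (\<lambda>i x. w i (x + g) - w i (x + g0)) \<le> ennreal (real n * \<eta>)"
    proof -
      have "pnorm p (\<lambda>x. w i (x + g) - w i (x + g0)) \<le> ennreal \<eta>" if i: "i < n" for i
      proof -
        note [measurable] = wm[OF i]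
        have "pnorm p (\<lambda>x. w i (x + g0 + (- g0 + g)) - w i (x + g0)) =
            pnorm p (\<lambda>x. w i (x + (- g0 + g)) - w i x)"
          by (rule pnorm_translate[where u = "\<lambda>x. w i (x + (- g0 + g)) - w i x"]) measurable
        moreover have "x + g0 + (- g0 + g) = x + g" for x
          by (simp add: add.assoc)
        ultimately show ?thesis using U(3)[OF i, of "- g0 + g"] g i by (simp add: V_def)
      qed
      then have "penergy p n (\<lambda>i x. w i (x + g) - w i (x + g0)) \<le> (\<Sum>i<n. ennreal \<eta>)"
        unfolding penergy_def by (intro sum_mono) auto
      also have "\<dots> = ennreal (real n * \<eta>)"
        using \<eta> by (simp add: ennreal_mult ennreal_of_nat_eq_real_of_nat)
      finally show ?thesis .
    qed
    have "penergy p n (\<lambda>i x. affine_action coboundary g v i x - affine_action coboundary g0 v0 i x) =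
        penergy p n (\<lambda>i x. (v i (x + g) - v0 i (x + g)) + (w i (x + g) - w i (x + g0)))"
      by (simp add: affine_action_def coboundary_def w_def algebra_simps)
    also have "\<dots> \<le> ennreal (2 powr p) *
        (penergy p n (\<lambda>i x. v i (x + g) - v0 i (x + g)) + penergy p n (\<lambda>i x. w i (x + g) - w i (x + g0)))"
      using p vm v0m wm
      by (intro penergy_add_le borel_measurable_diff measurable_compose[OF translate_measurable]) auto
    also have "\<dots> \<le> ennreal (2 powr p) * (ennreal \<eta> + ennreal (real n * \<eta>))"
      by (intro mult_left_mono add_mono e1 e2) simp
    also have "\<dots> = ennreal (2 powr p * (\<eta> + real n * \<eta>))"
      using \<eta> by (simp only: ennreal_mult ennreal_plus add_nonneg_nonneg mult_nonneg_nonneg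
          less_imp_le of_nat_0_le_iff powr_ge_zero)
    also have "2 powr p * (\<eta> + real n * \<eta>) = 2 powr p * (real n + 1) * \<eta>"
      by (simp add: algebra_simps)
    also have "\<dots> = (\<epsilon> / 2) powr p"
    proof -
      have "2 powr p * (real n + 1) \<noteq> 0" by (simp add: add_nonneg_eq_0_iff)
      then show ?thesis by (simp add: \<eta>_def)
    qed
    finally have "Lp_dist M p n (affine_action coboundary g v) (affine_action coboundary g0 v0) \<le> \<epsilon> / 2"
      using \<epsilon> by (subst Lp_dist_le_iff) (auto intro: action_closed v v0)
    then show ?thesis using \<epsilon> by simp
  qed
  ultimately show ?thesis
    using \<eta> by (intro exI[of _ V] exI[of _ "\<eta> powr (1 / p)"]) simp
qed

lemma coboundary_action: "continuous_affine_isometric_action M p n coboundary"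
proof -
  have zero: "Lp_dist M p n (affine_action coboundary 0 v) v = 0" for v
    by (simp add: Lp_dist_def affine_action_def coboundary_def)
  have add: "affine_action coboundary (g + h) v = affine_action coboundary g (affine_action coboundary h v)" for g h v
    by (simp add: affine_action_def coboundary_def fun_eq_iff add.assoc)
  have self: "Lp_dist M p n v v = 0" for v
    by (simp add: Lp_dist_def)
  show ?thesis
    unfolding continuous_affine_isometric_action_def
    using action_closed zero add self action_isometric action_continuous by simp
qed

lemma coboundary_Lp: "coboundary g \<in> Lp_sum M p n"
  by (simp add: Lp_sum_iff coboundary_meas coboundary_fin[unfolded infinity_ennreal_def])

lemma zero_Lp: "(\<lambda>_ _. 0) \<in> Lp_sum M p n"
  by (simp add: Lp_sum_iff pnorm_def)

text \<open>The linear part moves v by an amount bounded independently of g, so a bounded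
  displacement of v forces a bounded displacement of the origin, and properness has to be checked
  only there.\<close>

lemma coboundary_proper:
  assumes proper: "\<And>R. \<exists>B. compact B \<and> {g. penergy p n (coboundary g) \<le> ennreal R} \<subseteq> B"
  shows "metrically_proper_action M p n coboundary"
  unfolding metrically_proper_action_def
proof (intro ballI allI)
  fix v R assume v: "v \<in> Lp_sum M p n"
  have vm: "v i \<in> borel_measurable M" if "i < n" for i
    using v that by (auto simp: Lp_sum_iff)
  define e where "e = enn2real (penergy p n v)"
  have e: "penergy p n v = ennreal e" "0 \<le> e"
    unfolding e_def using penergy_finite[where v = v] v by (auto simp: Lp_sum_iff less_top)
  \<comment> \<open>The absolute value allows negative R; the inner term estimates v minus its
    translate, both of energy e.\<close>
  define R' where "R' = 2 powr p * (\<bar>R\<bar> powr p + 2 powr p * (e + e))"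
  have "penergy p n (coboundary g) \<le> ennreal R'"
    if "Lp_dist M p n (affine_action coboundary g v) v \<le> R" for g
  proof -
    have "Lp_dist M p n (affine_action coboundary g v) v \<le> \<bar>R\<bar>" using that by simp
    then have 1: "penergy p n (\<lambda>i x. affine_action coboundary g v i x - v i x) \<le> ennreal (\<bar>R\<bar> powr p)"
      using v action_closed by (subst (asm) Lp_dist_le_iff) auto
    have 2: "penergy p n (\<lambda>i x. - v i (x + g)) = ennreal e"
      using penergy_translate[OF vm, where p = p and g = g] e by (simp add: penergy_def pnorm_def)
    have "penergy p n (coboundary g) =
        penergy p n (\<lambda>i x. (affine_action coboundary g v i x - v i x) + (v i x + - v i (x + g)))"
      by (simp add: affine_action_def penergy_def)
    also have "\<dots> \<le> ennreal (2 powr p) * (penergy p n (\<lambda>i x. affine_action coboundary g v i x - v i x) +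
        penergy p n (\<lambda>i x. v i x + - v i (x + g)))"
      using p vm action_closed[OF v, of g]
      by (intro penergy_add_le borel_measurable_diff borel_measurable_add borel_measurable_uminus
          measurable_compose[OF translate_measurable]) (auto simp: Lp_sum_iff)
    also have "\<dots> \<le> ennreal (2 powr p) * (ennreal (\<bar>R\<bar> powr p) +
        ennreal (2 powr p) * (penergy p n v + penergy p n (\<lambda>i x. - v i (x + g))))"
      using p vm
      by (intro mult_left_mono add_mono 1 penergy_add_le borel_measurable_uminus
          measurable_compose[OF translate_measurable]) auto
    also have "\<dots> = ennreal R'"
      unfolding R'_def 2 e(1) using e(2)
      by (simp only: ennreal_mult ennreal_plus add_nonneg_nonneg mult_nonneg_nonneg powr_ge_zero)
    finally show ?thesis .
  qed
  moreover obtain B where B: "compact B" "{g. penergy p n (coboundary g) \<le> ennreal R'} \<subseteq> B"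
    using proper by blast
  ultimately have "{g. Lp_dist M p n (affine_action coboundary g v) v \<le> R} \<subseteq> B" by blast
  then have "closure {g. Lp_dist M p n (affine_action coboundary g v) v \<le> R} \<subseteq> B"
    using B(1) by (intro closure_minimal compact_imp_closed)
  then show "compact (closure {g. Lp_dist M p n (affine_action coboundary g v) v \<le> R})"
    using B(1) compact_Int_closed[OF B(1) closed_closure] by (metis inf.absorb2)
qed

lemma coboundary_lower:
  assumes "0 \<le> a" "penergy p n (coboundary g) \<ge> ennreal a"
  shows "Lp_dist M p n (coboundary g) (\<lambda>_ _. 0) \<ge> a powr (1 / p)"
proof -
  have fin: "penergy p n (coboundary g) < \<infinity>"
    by (intro penergy_finite coboundary_fin)
  then have "a \<le> enn2real (penergy p n (coboundary g))"
    using assms by (metis enn2real_ennreal enn2real_mono infinity_ennreal_def)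
  then show ?thesis
    using p assms(1) by (simp add: Lp_dist_Lp[OF coboundary_Lp zero_Lp] powr_mono2)
qed

end

end

section \<open>Hyperbolic groups\<close>

lemma is_word_Suc: "is_word S (Suc n) g \<longleftrightarrow> (\<exists>a\<in>S \<union> uminus ` S. \<exists>h. is_word S n h \<and> g = a + h)"
proof
  assume "is_word S (Suc n) g"
  then obtain xs where "length xs = Suc n" "set xs \<subseteq> S \<union> uminus ` S" "g = sum_list xs"
    by (auto simp: is_word_def)
  then show "\<exists>a\<in>S \<union> uminus ` S. \<exists>h. is_word S n h \<and> g = a + h"
    unfolding is_word_def by (cases xs) auto
next
  assume "\<exists>a\<in>S \<union> uminus ` S. \<exists>h. is_word S n h \<and> g = a + h"
  then obtain a xs where "a \<in> S \<union> uminus ` S" "length xs = n" "set xs \<subseteq> S \<union> uminus ` S" "g = a + sum_list xs"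
    unfolding is_word_def by blast
  then show "is_word S (Suc n) g"
    unfolding is_word_def by (intro exI[of _ "a # xs"]) simp
qed

lemma compact_is_word:
  fixes S :: "'g::topological_group_add set"
  assumes "compact S"
  shows "compact {g. is_word S n g}"
proof (induction n)
  case 0
  then show ?case by simp
next
  case (Suc n)
  have "compact (uminus ` S)"
    by (intro compact_continuous_image continuous_intros assms)
  then have "compact ((S \<union> uminus ` S) \<times> {g. is_word S n g})"
    by (intro compact_Times compact_Un assms Suc)
  then have "compact ((\<lambda>z. fst z + snd z) ` ((S \<union> uminus ` S) \<times> {g. is_word S n g}))"
    by (rule compact_continuous_image[rotated]) (intro continuous_intros)
  also have "(\<lambda>z. fst z + snd z) ` ((S \<union> uminus ` S) \<times> {g. is_word S n g}) = {g. is_word S (Suc n) g}"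
    by (fastforce simp: is_word_Suc image_iff)
  finally show ?case .
qed

lemma Hausdorff_space_t2: "Hausdorff_space (euclidean :: 'a::t2_space topology)"
proof -
  have "\<exists>U V. open U \<and> open V \<and> x \<in> U \<and> y \<in> V \<and> disjnt U V" if "x \<noteq> y" for x y :: 'a
    using hausdorff[OF that] unfolding disjnt_def .
  then show ?thesis by (simp add: Hausdorff_space_def)
qed

text \<open>Left translates of V are used so that a bound on word length over V becomes a bound on
  the word distance from z to x.\<close>

lemma compact_finite_translates:
  fixes K V :: "'g::topological_group_add set"
  assumes "compact K" "open V" "0 \<in> V"
  obtains Z where "finite Z" "\<And>x. x \<in> K \<Longrightarrow> \<exists>z\<in>Z. - z + x \<in> V"
proof -
  have "open {x. - z + x \<in> V}" for z
    using open_vimage[OF \<open>open V\<close>, of "\<lambda>x. - z + x"] by (simp add: vimage_def continuous_intros)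
  moreover have "K \<subseteq> (\<Union>z\<in>K. {x. - z + x \<in> V})" using \<open>0 \<in> V\<close> by auto
  ultimately obtain Z where "Z \<subseteq> K" "finite Z" "K \<subseteq> (\<Union>z\<in>Z. {x. - z + x \<in> V})"
    by (rule compactE_image[OF \<open>compact K\<close>, of K "\<lambda>z. {x. - z + x \<in> V}"])
  then show ?thesis using that[of Z] by blast
qed

locale hyperbolic_haar = generated_group S + right_haar M
  for S :: "'g::{topological_group_add,t2_space} set" and M :: "'g measure" +
  assumes locally_compact: "locally_compact_space (euclidean :: 'g topology)"
    and compact_S: "compact S"
    and hyperbolic: "gromov_hyperbolic (word_dist S)"
begin

section \<open>Measure and growth of word balls\<close>

lemma compact_len_le: "compact {g. len g \<le> n}"
proof -
  have "{g. len g \<le> n} = (\<Union>m\<le>n. {g. is_word S m g})"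
    using is_word_len len_le by (auto intro: order_trans)
  then show ?thesis by (auto intro!: compact_UN compact_is_word compact_S)
qed

lemma len_le_sets [measurable]: "{x. len x \<le> n} \<in> sets M"
  by (rule compact_in_sets[OF compact_len_le])

lemma len_measurable [measurable]: "len \<in> measurable M (count_space UNIV)"
proof -
  have "len -` {n} \<inter> space M \<in> sets M" for n
  proof -
    have "len -` {n} \<inter> space M = {x. len x \<le> n} - (\<Union>m<n. {x. len x \<le> m})"
      by (auto simp: not_le le_less)
    then show ?thesis by (simp only:) (intro sets.Diff sets.finite_UN len_le_sets finite_lessThan)
  qed
  then show ?thesis by (simp add: measurable_count_space_eq2_countable)
qed

text \<open>S is given as compact, not as a neighbourhood. Baire's theorem, applied to the group as
  a countable union of compact balls, yields a ball with interior, which is translated to 0. The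
  radius doubles because v = - a + (a + v) with both factors in that ball.\<close>

lemma identity_nhd:
  obtains q V where "open V" "0 \<in> V" "\<And>v. v \<in> V \<Longrightarrow> len v \<le> q"
proof -
  have "\<exists>n. interior {g. len g \<le> n} \<noteq> {}"
  proof (rule ccontr)
    assume "\<not> ?thesis"
    then have "euclidean interior_of (\<Union>(range (\<lambda>n. {g :: 'g. len g \<le> n}))) = {}"
      using locally_compact locally_compact_Hausdorff_imp_regular_space[OF _ Hausdorff_space_t2]
        compact_imp_closed[OF compact_len_le]
      by (intro Baire_category_alt) auto
    moreover have "(\<Union>(range (\<lambda>n. {g :: 'g. len g \<le> n}))) = UNIV" by auto
    ultimately show False by simp
  qed
  then obtain n a where a: "a \<in> interior {g. len g \<le> n}" by blast
  define V where "V = (\<lambda>v. a + v) -` interior {g. len g \<le> n}"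
  show ?thesis
  proof (rule that[of V "2 * n"])
    show "open V" unfolding V_def by (intro open_vimage open_interior continuous_intros)
    show "0 \<in> V" using a by (simp add: V_def)
    fix v assume "v \<in> V"
    then have "len (a + v) \<le> n" "len a \<le> n"
      using a interior_subset[of "{g. len g \<le> n}"] by (auto simp: V_def)
    moreover have "v = - a + (a + v)" by (simp add: add.assoc[symmetric])
    ultimately show "len v \<le> 2 * n"
      using len_add_le[of "- a" "a + v"] by simp
  qed
qed

text \<open>Rounding the first q + 1 letters of - x to a net point costs at most q, so one unit of
  radius is gained for a fixed number of translates. Passing to inverses turns left translates by
  the net into right translates, which M preserves.\<close>

lemma growth:
  obtains k where "k \<ge> 1" "\<And>m. emeasure M {x. len x \<le> m} \<le> ennreal (k ^ Suc m)"
proof -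
  obtain q V where V: "open V" "0 \<in> V" "\<And>v. v \<in> V \<Longrightarrow> len v \<le> q"
    by (rule identity_nhd) (rule that)
  obtain Z where Z: "finite Z" "\<And>x. x \<in> {x. len x \<le> Suc q} \<Longrightarrow> \<exists>z\<in>Z. - z + x \<in> uminus ` V"
  proof (rule compact_finite_translates[OF compact_len_le[of "Suc q"], of "uminus ` V"])
    have "uminus ` V = uminus -` V" by force
    then show "open (uminus ` V)" by (simp only:) (intro open_vimage V continuous_intros)
    show "0 \<in> uminus ` V" using V(2) by force
  qed blast
  define E where "E m = emeasure M {x. len x \<le> m}" for m
  have step: "E (q + Suc m) \<le> of_nat (card Z) * E (q + m)" for m
  proof -
    have "{x. len x \<le> q + Suc m} \<subseteq> (\<Union>z\<in>Z. {x. x + z \<in> {x. len x \<le> q + m}})"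
    proof
      fix x assume "x \<in> {x. len x \<le> q + Suc m}"
      then have x: "len (- x) \<le> q + Suc m" by simp
      obtain h where h: "len h \<le> Suc q" "dst h (- x) \<le> m"
      proof (cases "Suc q \<le> len (- x)")
        case True
        then obtain h where "len h = Suc q" "dst h (- x) = len (- x) - Suc q"
          by (rule geodesic_point)
        then show ?thesis using that[of h] x by simp
      next
        case False
        then show ?thesis using that[of "- x"] by (simp add: dst_def)
      qed
      obtain z where z: "z \<in> Z" "- z + h \<in> uminus ` V" using Z(2)[of h] h by blast
      then have "dst z h \<le> q" using V(3) by (auto simp: dst_def)
      then have "dst z (- x) \<le> q + m" using dst_triangle[of z "- x" h] h(2) by simp
      then have "len (x + z) \<le> q + m"
        using dst_commute[of z "- x"] by (simp add: dst_def)
      then show "x \<in> (\<Union>z\<in>Z. {x. x + z \<in> {x. len x \<le> q + m}})"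
        using z(1) by auto
    qed
    then have "E (q + Suc m) \<le> emeasure M (\<Union>z\<in>Z. {x. x + z \<in> {x. len x \<le> q + m}})"
      unfolding E_def using \<open>finite Z\<close>
      by (intro emeasure_mono sets.finite_UN translate_in_sets len_le_sets) auto
    also have "\<dots> \<le> (\<Sum>z\<in>Z. emeasure M {x. x + z \<in> {x. len x \<le> q + m}})"
      using \<open>finite Z\<close> by (intro emeasure_subadditive_finite image_subsetI translate_in_sets len_le_sets)
    also have "\<dots> = (\<Sum>z\<in>Z. E (q + m))"
      unfolding E_def by (intro sum.cong refl emeasure_translate len_le_sets)
    finally show ?thesis by simp
  qed
  have "E q < \<infinity>" unfolding E_def by (rule emeasure_compact[OF compact_len_le])
  then obtain e where e: "E q = ennreal e" "e \<ge> 0" by (cases "E q") auto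
  \<comment> \<open>Large enough for the initial value e, for the ratio card Z, and to be at least
    1.\<close>
  define k where "k = real (card Z) + e + 1"
  have k: "k \<ge> 1" "real (card Z) \<le> k" "e \<le> k" using e(2) by (simp_all add: k_def)
  have bound: "E (q + m) \<le> ennreal (k ^ Suc m)" for m
  proof (induction m)
    case 0
    then show ?case using e k by (simp add: ennreal_leI)
  next
    case (Suc m)
    have "E (q + Suc m) \<le> of_nat (card Z) * E (q + m)" by (rule step)
    also have "\<dots> \<le> ennreal k * ennreal (k ^ Suc m)"
      using k Suc by (intro mult_mono) (auto simp: ennreal_of_nat_eq_real_of_nat ennreal_leI)
    also have "\<dots> = ennreal (k ^ Suc (Suc m))"
      using k by (simp add: ennreal_mult[symmetric])
    finally show ?case .
  qed
  show ?thesis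
  proof (rule that[OF k(1)])
    fix m
    have "E m \<le> E (q + m)"
      unfolding E_def by (intro emeasure_mono len_le_sets) auto
    also have "\<dots> \<le> ennreal (k ^ Suc m)" by (rule bound)
    finally show "emeasure M {x. len x \<le> m} \<le> ennreal (k ^ Suc m)" by (simp add: E_def)
  qed
qed

lemma exp_len_integrable:
  obtains N where "N > 0" "\<And>a. a \<ge> N \<Longrightarrow> (\<integral>\<^sup>+x. ennreal (exp (- a * real (len x))) \<partial>M) < \<infinity>"
proof -
  obtain k where k: "k \<ge> 1" "\<And>m. emeasure M {x. len x \<le> m} \<le> ennreal (k ^ Suc m)"
    using growth by blast
  show ?thesis
  \<comment> \<open>From ln (2 * k) on, the decay beats the growth rate k by a factor 2 per unit of
    radius, leaving a geometric series.\<close>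
  proof (rule that[of "ln k + ln 2"])
    show "0 < ln k + ln 2" using k(1) by (intro add_nonneg_pos) auto
    fix a assume a: "ln k + ln 2 \<le> a"
    have "exp (- a) \<le> exp (- (ln k + ln 2))" using a by simp
    also have "\<dots> = inverse (exp (ln k) * exp (ln 2))" by (simp only: exp_minus exp_add)
    also have "\<dots> = 1 / (2 * k)" using k(1) by (simp add: field_simps)
    finally have e: "exp (- a) \<le> 1 / (2 * k)" .
    have summand: "ennreal (exp (- a * real m)) * emeasure M {x. len x \<le> m} \<le> ennreal (k * (1 / 2) ^ m)" for m
    proof -
      have "exp (- a * real m) = exp (- a) ^ m" by (simp add: exp_of_nat_mult[symmetric] mult.commute)
      also have "\<dots> \<le> (1 / (2 * k)) ^ m" using e by (intro power_mono) auto
      finally have "ennreal (exp (- a * real m)) * emeasure M {x. len x \<le> m} \<le>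
          ennreal ((1 / (2 * k)) ^ m) * ennreal (k ^ Suc m)"
        using k(2) by (intro mult_mono ennreal_leI) auto
      also have "\<dots> = ennreal ((1 / (2 * k)) ^ m * k ^ Suc m)"
        using k(1) by (intro ennreal_mult[symmetric]) auto
      also have "(1 / (2 * k)) ^ m * k ^ Suc m = k * (1 / 2) ^ m"
        using k(1) by (simp add: power_divide power_mult_distrib)
      finally show ?thesis .
    qed
    have "(\<integral>\<^sup>+x. ennreal (exp (- a * real (len x))) \<partial>M) \<le>
        (\<integral>\<^sup>+x. (\<Sum>m. ennreal (exp (- a * real m)) * indicator {x. len x \<le> m} x) \<partial>M)"
    proof (intro nn_integral_mono)
      fix x
      \<comment> \<open>The single summand m = len x suffices.\<close>
      show "ennreal (exp (- a * real (len x))) \<le>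
          (\<Sum>m. ennreal (exp (- a * real m)) * indicator {x. len x \<le> m} x)"
        using sum_le_suminf[of "\<lambda>m. ennreal (exp (- a * real m)) * indicator {x. len x \<le> m} x" "{len x}"]
        by (auto simp del: mult_minus_left)
    qed
    also have "\<dots> = (\<Sum>m. \<integral>\<^sup>+x. ennreal (exp (- a * real m)) * indicator {x. len x \<le> m} x \<partial>M)"
      by (intro nn_integral_suminf) measurable
    also have "\<dots> = (\<Sum>m. ennreal (exp (- a * real m)) * emeasure M {x. len x \<le> m})"
      by (intro suminf_cong nn_integral_cmult_indicator len_le_sets)
    also have "\<dots> \<le> (\<Sum>m. ennreal (k * (1 / 2) ^ m))"
      by (intro suminf_le summand) auto
    also have "\<dots> = ennreal (\<Sum>m. k * (1 / 2) ^ m)"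
      using k(1) by (intro suminf_ennreal2 summable_mult summable_geometric) auto
    also have "\<dots> < \<infinity>" by simp
    finally show "(\<integral>\<^sup>+x. ennreal (exp (- a * real (len x))) \<partial>M) < \<infinity>" .
  qed
qed

text \<open>Balls have finite nets, so the whole group has a countable one, and x goes to the first
  net point in an enumeration whose translate of V contains it. The index is measurable into a
  discrete space, so every f becomes measurable after composition.\<close>

lemma net_projection:
  assumes V: "open V" "0 \<in> V"
  obtains \<pi> where "\<And>x. - \<pi> x + x \<in> V" "\<And>f :: 'g \<Rightarrow> real. (\<lambda>x. f (\<pi> x)) \<in> borel_measurable M"
proof -
  have "\<exists>Z. finite Z \<and> (\<forall>x\<in>{x. len x \<le> n}. \<exists>z\<in>Z. - z + x \<in> V)" for n
    using compact_finite_translates[OF compact_len_le[of n] V] by metis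
  then obtain Z where Z: "\<And>n. finite (Z n)" "\<And>n x. len x \<le> n \<Longrightarrow> \<exists>z\<in>Z n. - z + x \<in> V"
    by (simp add: Ball_def) metis
  define C where "C = (\<Union>n. Z n)"
  have "countable C" unfolding C_def using Z(1) by (intro countable_UN) (auto intro: countable_finite)
  have C: "\<exists>z\<in>C. - z + x \<in> V" for x
    using Z(2)[of x "len x"] by (auto simp: C_def)
  then have "C \<noteq> {}" by blast
  define z where "z = from_nat_into C"
  have ex: "\<exists>j. - z j + x \<in> V" for x
    using C[of x] from_nat_into_surj[OF \<open>countable C\<close>] unfolding z_def by metis
  define J where "J x = (LEAST j. - z j + x \<in> V)" for x
  have "open {x. - z j + x \<in> V}" for j
    using open_vimage[OF V(1), of "\<lambda>x. - z j + x"] by (simp add: vimage_def continuous_intros)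
  then have [measurable]: "Measurable.pred M (\<lambda>x. - z j + x \<in> V)" for j
    by (simp add: pred_def open_in_sets)
  have "J \<in> measurable M (count_space UNIV)"
    unfolding J_def by measurable
  then have "(\<lambda>x. f (z (J x))) \<in> borel_measurable M" for f :: "'g \<Rightarrow> real"
    by (rule measurable_compose) simp
  moreover have "- z (J x) + x \<in> V" for x
    unfolding J_def using ex by (rule LeastI_ex)
  ultimately show ?thesis using that[of "\<lambda>x. z (J x)"] by blast
qed

section \<open>Visual functions and separation of directions\<close>

lemma hyperbolic_gp:
  obtains \<delta> where "\<delta> \<ge> 0" "\<And>x y z. gp x z \<ge> min (gp x y) (gp y z) - \<delta>"
proof -
  obtain \<delta> where "\<delta> \<ge> 0" "\<forall>w x y z. gromov_product (word_dist S) w x z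
      \<ge> min (gromov_product (word_dist S) w x y) (gromov_product (word_dist S) w y z) - \<delta>"
    using hyperbolic unfolding gromov_hyperbolic_def by blast
  then show ?thesis
    using that[of \<delta>] gromov_product_eq by metis
qed

text \<open>The hyperbolic inequality, exponentiated, is the quasi-ultrametric inequality that
  \<open>frink_lipschitz_function\<close> requires, with constant exp (\<epsilon> * \<delta>). Each
  base point w gives one function.\<close>

lemma visual_functions:
  obtains \<epsilon> \<delta> f where "\<epsilon> > 0" "\<delta> \<ge> 0" "\<And>x y z. gp x z \<ge> min (gp x y) (gp y z) - \<delta>"
    "\<And>w x y. \<bar>f w x - f w y\<bar> \<le> exp (- \<epsilon> * gp x y)"
    "\<And>w x. f w x \<le> exp (- \<epsilon> * gp x w)"
    "\<And>w x. exp (- \<epsilon> * gp x w) / 2 \<le> f w x"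
proof -
  obtain \<delta> where \<delta>: "\<delta> \<ge> 0" "\<And>x y z. gp x z \<ge> min (gp x y) (gp y z) - \<delta>"
    by (rule hyperbolic_gp) (rule that)
  \<comment> \<open>Ensures 2 * \<epsilon> * \<delta> \<le> ln 2, that is, \<open>K\<^sup>2\<close>
    at most 2; the summand 1 covers \<delta> = 0.\<close>
  define \<epsilon> where "\<epsilon> = ln 2 / (2 * (\<delta> + 1))"
  have \<epsilon>: "\<epsilon> > 0" using \<delta>(1) by (simp add: \<epsilon>_def)
  define K where "K = exp (\<epsilon> * \<delta>)"
  have K1: "1 \<le> K" using \<epsilon> \<delta>(1) by (simp add: K_def)
  have "2 * (\<epsilon> * \<delta>) \<le> 2 * (\<epsilon> * (\<delta> + 1))"
    using \<epsilon> by simp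
  also have "\<dots> = ln 2" using \<delta>(1) by (simp add: \<epsilon>_def field_simps)
  finally have "exp (2 * (\<epsilon> * \<delta>)) \<le> exp (ln 2)" by (simp only: exp_le_cancel_iff)
  then have K2: "K\<^sup>2 \<le> 2" by (simp add: K_def exp_double[symmetric])
  define \<rho> where "\<rho> x y = exp (- \<epsilon> * gp x y)" for x y
  have nonneg: "0 \<le> \<rho> x y" for x y by (simp add: \<rho>_def)
  have sym: "\<rho> x y = \<rho> y x" for x y by (simp add: \<rho>_def gp_commute)
  have quasi: "\<rho> x z \<le> K * max (\<rho> x y) (\<rho> y z)" for x y z
  proof -
    have *: "\<rho> x z \<le> K * exp (- \<epsilon> * s)" if "gp x z \<ge> s - \<delta>" for s
    proof -
      have "\<epsilon> * (s - \<delta>) \<le> \<epsilon> * gp x z" using that \<epsilon> by simp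
      then have "- \<epsilon> * gp x z \<le> \<epsilon> * \<delta> + - \<epsilon> * s" by (simp add: algebra_simps)
      then show ?thesis unfolding \<rho>_def K_def exp_add[symmetric] by simp
    qed
    have "\<rho> x z \<le> K * \<rho> x y \<or> \<rho> x z \<le> K * \<rho> y z"
      using *[of "gp x y"] *[of "gp y z"] \<delta>(2)[of x y z] unfolding \<rho>_def[symmetric]
      by (auto simp: min_def split: if_splits)
    moreover have "K * \<rho> x y \<le> K * max (\<rho> x y) (\<rho> y z)" "K * \<rho> y z \<le> K * max (\<rho> x y) (\<rho> y z)"
      using K1 by (intro mult_left_mono; simp)+
    ultimately show ?thesis by linarith
  qed
  have "\<exists>f. (\<forall>x y. \<bar>f x - f y\<bar> \<le> \<rho> x y) \<and> (\<forall>x. f x \<le> \<rho> x w) \<and> (\<forall>x. \<rho> x w / 2 \<le> f x)" for w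
    by (rule frink_lipschitz_function[of \<rho> K w, OF nonneg sym quasi K1 K2]) blast
  then obtain f where "\<And>w x y. \<bar>f w x - f w y\<bar> \<le> \<rho> x y" "\<And>w x. f w x \<le> \<rho> x w"
    "\<And>w x. \<rho> x w / 2 \<le> f w x"
    by metis
  then show ?thesis
    using that[OF \<epsilon> \<delta>] unfolding \<rho>_def by blast
qed

text \<open>Points far from the identity whose Gromov product is bounded lie in different directions, and
  a bounded ball already contains enough base points to tell these directions apart.\<close>

lemma separating_functions:
  assumes \<epsilon>: "\<epsilon> > 0" and \<delta>: "\<delta> \<ge> 0" "\<And>x y z. gp x z \<ge> min (gp x y) (gp y z) - \<delta>"
    and f: "\<And>w x. f w x \<le> exp (- \<epsilon> * gp x w)" "\<And>w x. exp (- \<epsilon> * gp x w) / 2 \<le> f w x"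
    and r: "r \<ge> 0"
  obtains Z R c where "finite Z" "c > 0"
    "\<And>x y. len x \<ge> R \<Longrightarrow> gp x y \<le> r \<Longrightarrow> \<exists>w\<in>Z. \<bar>f w x - f w y\<bar> \<ge> c"
proof -
  obtain V q where V: "open V" "0 \<in> V" "\<And>v. v \<in> V \<Longrightarrow> len v \<le> q"
    by (rule identity_nhd) (rule that)
  \<comment> \<open>Solves exp (- \<epsilon> * t) = c below: then f w x is at most c while f w y is
    at least 2 * c.\<close>
  define t where "t = r + \<delta> + ln 4 / \<epsilon>"
  have t: "t > r + \<delta>" using \<epsilon> by (simp add: t_def)
  \<comment> \<open>The point at distance R from the identity on a geodesic to x is rounded to a net
    point w at cost q, which leaves gp x w \<ge> R - q \<ge> t.\<close>
  define R where "R = q + nat \<lceil>t\<rceil>"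
  have Rt: "real R - real q \<ge> t" by (simp add: R_def real_nat_ceiling_ge)
  define c where "c = exp (- \<epsilon> * (r + \<delta>)) / 4"
  have "exp (- \<epsilon> * t) = exp (- \<epsilon> * (r + \<delta>) - ln 4)"
    using \<epsilon> by (simp add: t_def algebra_simps)
  also have "\<dots> = c" by (simp add: c_def exp_diff)
  finally have ct: "exp (- \<epsilon> * t) = c" .
  obtain Z where Z: "finite Z" "\<And>x. x \<in> {x. len x \<le> R} \<Longrightarrow> \<exists>z\<in>Z. - z + x \<in> V"
    by (rule compact_finite_translates[OF compact_len_le[of R] V(1,2)]) (rule that)
  have "\<exists>w\<in>Z. \<bar>f w x - f w y\<bar> \<ge> c" if x: "len x \<ge> R" and xy: "gp x y \<le> r" for x y
  proof -
    obtain h where h: "len h = R" "dst h x = len x - R"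
      using x by (rule geodesic_point)
    obtain w where w: "w \<in> Z" "- w + h \<in> V" using Z(2)[of h] h by auto
    then have "dst w h \<le> q" using V(3) by (simp add: dst_def)
    then have "real (dst x w) \<le> real (len x) - real R + real q" "real (len w) \<ge> real R - real q"
      using dst_triangle[of w x h] dst_commute[of x w] h x dst_triangle[of 0 h w] by simp_all
    then have "gp x w \<ge> real R - real q"
      unfolding gp_def by (simp add: field_simps)
    then have xw: "gp x w \<ge> t" using Rt by simp
    \<comment> \<open>gp x w exceeds r + \<delta>, so the minimum in the hyperbolic inequality
      cannot be gp x w and must be gp w y.\<close>
    then have wy: "gp w y \<le> r + \<delta>"
      using \<delta>(2)[of x w y] xy t by (auto simp: min_def split: if_splits)
    have "f w x \<le> exp (- \<epsilon> * gp x w)" by (rule f(1))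
    also have "\<dots> \<le> exp (- \<epsilon> * t)" using xw \<epsilon> by simp
    finally have "f w x \<le> c" using ct by simp
    moreover have "exp (- \<epsilon> * (r + \<delta>)) \<le> exp (- \<epsilon> * gp y w)"
      using wy \<epsilon> by (simp add: gp_commute)
    then have "2 * c \<le> f w y"
      using f(2)[of y w] unfolding c_def by linarith
    ultimately show ?thesis using w(1) by (intro bexI[of _ w]) auto
  qed
  moreover have "c > 0" by (simp add: c_def)
  ultimately show ?thesis using that[OF Z(1)] by blast
qed

section \<open>Translation continuity beyond L_p\<close>

lemma len_tail_small:
  assumes fin: "pnorm p h < \<infinity>" and [measurable]: "h \<in> borel_measurable M" and "\<eta> > 0" and p: "p > 0"
  obtains m where "pnorm p (\<lambda>x. h x * indicator {x. m < len x} x) \<le> ennreal \<eta>"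
proof -
  have "(\<lambda>m. \<integral>\<^sup>+x. ennreal (\<bar>h x * indicator {x. m < len x} x\<bar> powr p) \<partial>M) \<longlonglongrightarrow> (\<integral>\<^sup>+x. 0 \<partial>M)"
  proof (rule nn_integral_dominated_convergence[where w = "\<lambda>x. ennreal (\<bar>h x\<bar> powr p)"])
    show "(\<integral>\<^sup>+x. ennreal (\<bar>h x\<bar> powr p) \<partial>M) < \<infinity>" using fin by (simp add: pnorm_def)
    show "AE x in M. (\<lambda>m. ennreal (\<bar>h x * indicator {x. m < len x} x\<bar> powr p)) \<longlonglongrightarrow> 0"
    proof (intro AE_I2 tendsto_eventually)
      fix x
      show "eventually (\<lambda>m. ennreal (\<bar>h x * indicator {x. m < len x} x\<bar> powr p) = 0) sequentially"
        using eventually_ge_at_top[of "len x"] by eventually_elim (simp add: indicator_def)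
    qed
    show "AE x in M. ennreal (\<bar>h x * indicator {x. m < len x} x\<bar> powr p) \<le> ennreal (\<bar>h x\<bar> powr p)" for m
      using p by (intro AE_I2 ennreal_leI powr_mono2) (auto simp: indicator_def)
  qed measurable
  then have "(\<lambda>m. pnorm p (\<lambda>x. h x * indicator {x. m < len x} x)) \<longlonglongrightarrow> 0"
    by (simp add: pnorm_def)
  then have "eventually (\<lambda>m. pnorm p (\<lambda>x. h x * indicator {x. m < len x} x) < ennreal \<eta>) sequentially"
    using \<open>\<eta> > 0\<close> by (intro order_tendstoD) auto
  then obtain m where "pnorm p (\<lambda>x. h x * indicator {x. m < len x} x) < ennreal \<eta>"
    by (auto simp: eventually_sequentially)
  then show ?thesis using that[of m] by simp
qed

text \<open>G need not be p-integrable. Inside a large ball it is replaced by a truncation in L_p;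
  outside, h bounds the variation uniformly in u and has a small tail.\<close>

lemma tcont_small_variation:
  assumes p: "p > 0" and G[measurable]: "G \<in> borel_measurable M" and G_bound: "\<And>x. \<bar>G x\<bar> \<le> 1"
    and h[measurable]: "h \<in> borel_measurable M" and h_fin: "pnorm p h < \<infinity>"
    and V: "open V" "0 \<in> V" "\<And>v. v \<in> V \<Longrightarrow> len v \<le> q"
    and var: "\<And>x u. u \<in> V \<Longrightarrow> \<bar>G (x + u) - G x\<bar> \<le> \<bar>h x\<bar>"
  shows "tcont p G"
  unfolding tcont_def
proof (intro conjI allI impI G)
  fix \<eta> :: real assume "\<eta> > 0"
  then have \<eta>2: "\<eta> / 2 > 0" by simp
  obtain m where m: "pnorm p (\<lambda>x. h x * indicator {x. m < len x} x) \<le> ennreal (\<eta> / 2)"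
    by (rule len_tail_small[OF h_fin h \<eta>2 p]) (rule that)
  \<comment> \<open>The margin q keeps both x and x + u inside the truncation ball when len x \<le>
    m and u is in V.\<close>
  define F where "F x = G x * indicator {x. len x \<le> m + q} x" for x
  have [measurable]: "F \<in> borel_measurable M" unfolding F_def by measurable
  have "pnorm p F \<le> pnorm p (indicator {x. len x \<le> m + q})"
    using G_bound by (intro pnorm_mono p) (simp add: F_def indicator_def)
  also have "\<dots> = emeasure M {x. len x \<le> m + q}"
    by (rule pnorm_indicator[OF len_le_sets])
  also have "\<dots> < \<infinity>" by (rule emeasure_compact[OF compact_len_le])
  finally have "tcont p F" by (intro tcont_Lp p) measurable
  then obtain U where U: "open U" "0 \<in> U" "\<And>u. u \<in> U \<Longrightarrow> pnorm p (\<lambda>x. F (x + u) - F x) \<le> ennreal (\<eta> / 2)"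
    using \<eta>2 by (rule tcontD) (rule that)
  have "pnorm p (\<lambda>x. G (x + u) - G x) \<le> ennreal \<eta>" if u: "u \<in> U \<inter> V" for u
  proof -
    have pw: "\<bar>G (x + u) - G x\<bar> powr p \<le>
        \<bar>F (x + u) - F x\<bar> powr p + \<bar>h x * indicator {x. m < len x} x\<bar> powr p" for x
    proof (cases "len x \<le> m")
      case True
      moreover have "len (x + u) \<le> m + q"
        using True V(3)[of u] u len_add_le[of x u] by simp
      ultimately show ?thesis by (simp add: F_def)
    next
      case False
      have "\<bar>G (x + u) - G x\<bar> powr p \<le> \<bar>h x\<bar> powr p"
        using var[of u x] u p by (intro powr_mono2) auto
      then show ?thesis using False by (simp add: add_increasing)
    qed
    have "pnorm p (\<lambda>x. G (x + u) - G x) \<le>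
        (\<integral>\<^sup>+x. ennreal (\<bar>F (x + u) - F x\<bar> powr p) + ennreal (\<bar>h x * indicator {x. m < len x} x\<bar> powr p) \<partial>M)"
      unfolding pnorm_def using pw
      by (intro nn_integral_mono) (simp add: ennreal_plus[symmetric] ennreal_leI del: ennreal_plus)
    also have "\<dots> = pnorm p (\<lambda>x. F (x + u) - F x) + pnorm p (\<lambda>x. h x * indicator {x. m < len x} x)"
      unfolding pnorm_def by (intro nn_integral_add) measurable
    also have "\<dots> \<le> ennreal (\<eta> / 2) + ennreal (\<eta> / 2)"
      using U(3) u m by (intro add_mono) auto
    also have "\<dots> = ennreal \<eta>"
      using \<open>\<eta> > 0\<close> by (simp add: ennreal_plus[symmetric] del: ennreal_plus)
    finally show ?thesis .
  qed
  then show "\<exists>U. open U \<and> 0 \<in> U \<and> (\<forall>u\<in>U. pnorm p (\<lambda>x. G (x + u) - G x) \<le> ennreal \<eta>)"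
    using U V(1,2) by (intro exI[of _ "U \<inter> V"]) auto
qed

text \<open>The set of points x such that the left translate by x of a fixed geodesic from 0 to g passes
  near 0 has measure at least proportional to the length of the geodesic, since right translation
  preserves M.\<close>

lemma geodesic_translates:
  assumes q: "emeasure M {x. len x \<le> q} = ennreal \<mu>" "\<mu> > 0" and D: "D = 2 * q + 1"
    and g: "len g \<ge> 2 * (i0 + D)"
  obtains A where "A \<in> sets M" "emeasure M A \<ge> ennreal (\<mu> / (2 * real D) * real (len g))"
    "\<And>x. x \<in> A \<Longrightarrow> len x + q \<ge> i0" "\<And>x. x \<in> A \<Longrightarrow> gp x (x + g) \<le> real q"
proof -
  obtain \<gamma> where \<gamma>: "\<And>i. i \<le> len g \<Longrightarrow> len (\<gamma> i) = i" "\<And>i. i \<le> len g \<Longrightarrow> dst (\<gamma> i) g = len g - i"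
    "\<And>i j. i \<le> j \<Longrightarrow> j \<le> len g \<Longrightarrow> dst (\<gamma> i) (\<gamma> j) = j - i"
    by (rule geodesic) (rule that)
  define J where "J = (len g - i0) div D"
  define s where "s j = i0 + j * D" for j
  have s: "s j \<le> len g" if "j < J" for j
  proof -
    have "j * D \<le> J * D" using that by (intro mult_le_mono1) simp
    also have "\<dots> \<le> len g - i0" by (simp add: J_def)
    finally show ?thesis using g by (simp add: s_def)
  qed
  \<comment> \<open>The ball of radius q moved on the right by - \<gamma> (s j), hence of measure
    \<mu>.\<close>
  define B where "B j = {x. x + \<gamma> (s j) \<in> {x. len x \<le> q}}" for j
  have B_sets: "B j \<in> sets M" for j
    unfolding B_def by (intro translate_in_sets len_le_sets)
  have far: "B j \<inter> B j' = {}" if "j < j'" "j' < J" for j j'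
  proof (rule ccontr)
    assume "B j \<inter> B j' \<noteq> {}"
    then obtain x where x: "len (x + \<gamma> (s j)) \<le> q" "len (x + \<gamma> (s j')) \<le> q" by (auto simp: B_def)
    \<comment> \<open>Left translation by x is an isometry, so two marks carried into the q-ball are
      at distance at most 2 * q, less than the spacing D.\<close>
    have "- \<gamma> (s j) + \<gamma> (s j') = - (x + \<gamma> (s j)) + (x + \<gamma> (s j'))"
      by (simp only: minus_add add.assoc minus_add_cancel)
    then have "dst (\<gamma> (s j)) (\<gamma> (s j')) \<le> 2 * q"
      using len_add_le[of "- (x + \<gamma> (s j))" "x + \<gamma> (s j')"] x unfolding dst_def by (simp del: minus_add)
    moreover have "s j + D \<le> s j'"
    proof -
      have "Suc j * D \<le> j' * D" using that by (intro mult_le_mono1) simp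
      then show ?thesis by (simp add: s_def)
    qed
    ultimately show False
      using \<gamma>(3)[of "s j" "s j'"] s[of j'] that D by simp
  qed
  have disj: "disjoint_family_on B {..<J}"
    unfolding disjoint_family_on_def
  proof (intro ballI impI)
    fix j j' assume "j \<in> {..<J}" "j' \<in> {..<J}" "j \<noteq> j'"
    then show "B j \<inter> B j' = {}"
      using far[of j j'] far[of j' j] by (cases "j < j'") auto
  qed
  define A where "A = (\<Union>j<J. B j)"
  have A_sets: "A \<in> sets M" unfolding A_def using B_sets by (intro sets.finite_UN) auto
  have "emeasure M A = (\<Sum>j<J. emeasure M (B j))"
    unfolding A_def using B_sets disj by (intro sum_emeasure[symmetric]) auto
  also have "\<dots> = (\<Sum>j<J. ennreal \<mu>)"
    unfolding B_def q(1)[symmetric] by (intro sum.cong refl emeasure_translate len_le_sets)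
  also have "\<dots> = ennreal (real J * \<mu>)"
    using q(2) by (simp add: ennreal_mult ennreal_of_nat_eq_real_of_nat)
  finally have A_measure: "emeasure M A = ennreal (real J * \<mu>)" .
  have "D > 0" using D by simp
  have "len g - i0 < Suc J * D"
    unfolding J_def using \<open>D > 0\<close> dividend_less_div_times[of D "len g - i0"] by simp
  then have "len g < i0 + D + J * D" by simp
  \<comment> \<open>The part i0 + D lost at the ends is at most half of len g, whence the factor
    2.\<close>
  then have "len g \<le> 2 * (J * D)" using g by simp
  then have "real (len g) \<le> 2 * real D * real J"
    by (metis (no_types, opaque_lifting) mult.assoc mult.commute of_nat_le_iff of_nat_mult of_nat_numeral)
  then have "\<mu> / (2 * real D) * real (len g) \<le> \<mu> / (2 * real D) * (2 * real D * real J)"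
    using q(2) by (intro mult_left_mono) auto
  also have "\<dots> = real J * \<mu>" using \<open>D > 0\<close> by simp
  finally have "emeasure M A \<ge> ennreal (\<mu> / (2 * real D) * real (len g))"
    unfolding A_measure by (rule ennreal_leI)
  moreover have "len x + q \<ge> i0 \<and> gp x (x + g) \<le> real q" if x: "x \<in> A" for x
  proof -
    obtain j where j: "j < J" "len (x + \<gamma> (s j)) \<le> q" using x by (auto simp: A_def B_def)
    have sj: "s j \<le> len g" using s j by simp
    have e1: "x = (x + \<gamma> (s j)) + - \<gamma> (s j)" "\<gamma> (s j) = - x + (x + \<gamma> (s j))"
      by (simp_all only: add.assoc left_minus right_minus add_0_right minus_add_cancel)
    have e2: "x + g = (x + \<gamma> (s j)) + (- \<gamma> (s j) + g)"
      by (simp add: add.assoc)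
    have "len x \<le> q + s j"
      using len_add_le[of "x + \<gamma> (s j)" "- \<gamma> (s j)"] e1(1) j(2) \<gamma>(1)[OF sj] by simp
    moreover have "s j \<le> len x + q"
      using len_add_le[of "- x" "x + \<gamma> (s j)"] e1(2) j(2) \<gamma>(1)[OF sj] by simp
    moreover have "len (x + g) \<le> q + (len g - s j)"
      using len_add_le[of "x + \<gamma> (s j)" "- \<gamma> (s j) + g"] e2 j(2) \<gamma>(2)[OF sj] by (simp add: dst_def)
    \<comment> \<open>Through the marked point, len x + len (x + g) \<le> 2 * q + len g, and len g
      is the distance from x to x + g; half the excess is q.\<close>
    ultimately show ?thesis
      using sj unfolding gp_def by (simp add: s_def)
  qed
  ultimately show ?thesis using that[OF A_sets] by blast
qed

section \<open>The cocycle and its growth\<close>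

lemma pnorm_exp_len:
  assumes "(\<integral>\<^sup>+x. ennreal (exp (- (\<epsilon> * p) * real (len x))) \<partial>M) < \<infinity>"
  shows "pnorm p (\<lambda>x. C * exp (- \<epsilon> * real (len x))) < \<infinity>"
proof -
  have "pnorm p (\<lambda>x. exp (- \<epsilon> * real (len x))) = (\<integral>\<^sup>+x. ennreal (exp (- (\<epsilon> * p) * real (len x))) \<partial>M)"
    unfolding pnorm_def by (intro nn_integral_cong) (simp add: exp_powr_real mult_ac)
  then show ?thesis
    using assms by (simp add: pnorm_cmult ennreal_mult_less_top)
qed

lemma proper_affine_action:
  "\<exists>N. \<forall>p\<ge>N. \<exists>n c.
           continuous_affine_isometric_action M p n c \<and>
           metrically_proper_action M p n c \<and>
           (\<exists>C>0. \<exists>K. \<forall>g. word_length S g \<ge> K \<longrightarrow>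
               Lp_dist M p n (c g) (\<lambda>_ _. 0) \<ge> C * word_length S g powr (1 / p))"
proof -
  obtain q V where V: "open V" "0 \<in> V" "\<And>v. v \<in> V \<Longrightarrow> len v \<le> q"
    by (rule identity_nhd) (rule that)
  obtain \<pi> where \<pi>: "\<And>x. - \<pi> x + x \<in> V" "\<And>f :: 'g \<Rightarrow> real. (\<lambda>x. f (\<pi> x)) \<in> borel_measurable M"
    by (rule net_projection[OF V(1,2)]) (rule that)
  have \<pi>_dst: "dst x (\<pi> x) \<le> q" for x
    using V(3)[OF \<pi>(1)[of x]] dst_commute[of x "\<pi> x"] by (simp add: dst_def)
  obtain \<epsilon> \<delta> f where \<epsilon>: "\<epsilon> > 0" and \<delta>: "\<delta> \<ge> 0" "\<And>x y z. gp x z \<ge> min (gp x y) (gp y z) - \<delta>"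
    and f: "\<And>w x y. \<bar>f w x - f w y\<bar> \<le> exp (- \<epsilon> * gp x y)"
    "\<And>w x. f w x \<le> exp (- \<epsilon> * gp x w)" "\<And>w x. exp (- \<epsilon> * gp x w) / 2 \<le> f w x"
    by (rule visual_functions) (rule that)
  \<comment> \<open>3 * q is q from \<open>geodesic_translates\<close> plus 2 * q for rounding both
    points by \<pi>.\<close>
  obtain Z R c where Z: "finite Z" and c: "c > 0"
    and sep: "\<And>x y. len x \<ge> R \<Longrightarrow> gp x y \<le> 3 * real q \<Longrightarrow> \<exists>w\<in>Z. \<bar>f w x - f w y\<bar> \<ge> c"
    by (rule separating_functions[OF \<epsilon> \<delta> f(2,3), of "3 * real q"]) (simp, rule that)
  obtain N where N: "N > 0" "\<And>a. a \<ge> N \<Longrightarrow> (\<integral>\<^sup>+x. ennreal (exp (- a * real (len x))) \<partial>M) < \<infinity>"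
    by (rule exp_len_integrable) (rule that)
  \<comment> \<open>An enumeration of the base points, repetitions allowed; each index gives one
    copy of L_p(G).\<close>
  obtain n z where z: "Z = z ` {i::nat. i < n}"
    using Z unfolding finite_conv_nat_seg_image by blast
  \<comment> \<open>f itself need not be measurable; \<pi> takes countably many values on Borel pieces.\<close>
  define F where "F i x = f (z i) (\<pi> x)" for i x
  have F_meas: "F i \<in> borel_measurable M" for i
    unfolding F_def by (rule \<pi>(2))
  have F_bound: "\<bar>F i x\<bar> \<le> 1" for i x
  proof -
    have "0 \<le> f (z i) (\<pi> x)"
      using f(3)[of "\<pi> x" "z i"] exp_ge_zero[of "- \<epsilon> * gp (\<pi> x) (z i)"] by linarith
    moreover have "exp (- \<epsilon> * gp (\<pi> x) (z i)) \<le> 1"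
      using \<epsilon> gp_nonneg by simp
    then have "f (z i) (\<pi> x) \<le> 1"
      using f(2)[of "z i" "\<pi> x"] by linarith
    ultimately show ?thesis by (simp add: F_def)
  qed
  \<comment> \<open>l bounds len g instead of equalling it, so that one majorant serves all of V as
    well as a single g.\<close>
  have F_var: "\<bar>F i (x + g) - F i x\<bar> \<le> exp (\<epsilon> * real (l + 2 * q)) * exp (- \<epsilon> * real (len x))"
    if "len g \<le> l" for i x g l
  proof -
    have "gp (\<pi> x) (\<pi> (x + g)) \<ge> real (len x) - real l - 2 * real q"
      using gp_perturb[OF \<pi>_dst[of x] \<pi>_dst[of "x + g"]] gp_add_ge[of x g] that by linarith
    then have "\<epsilon> * (real (len x) - real l - 2 * real q) \<le> \<epsilon> * gp (\<pi> (x + g)) (\<pi> x)"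
      using \<epsilon> by (simp add: gp_commute)
    then have "- \<epsilon> * gp (\<pi> (x + g)) (\<pi> x) \<le> \<epsilon> * real (l + 2 * q) + - \<epsilon> * real (len x)"
      by (simp add: algebra_simps)
    then have "exp (- \<epsilon> * gp (\<pi> (x + g)) (\<pi> x)) \<le> exp (\<epsilon> * real (l + 2 * q)) * exp (- \<epsilon> * real (len x))"
      unfolding exp_add[symmetric] by simp
    then show ?thesis
      unfolding F_def by (rule order_trans[OF f(1)])
  qed
  define \<mu> where "\<mu> = enn2real (emeasure M {x. len x \<le> q})"
  have fin: "emeasure M {x. len x \<le> q} < \<infinity>"
    by (rule emeasure_compact[OF compact_len_le])
  have "0 < emeasure M V"
    using V by (intro emeasure_open_pos) auto
  also have "\<dots> \<le> emeasure M {x. len x \<le> q}"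
    using V(3) by (intro emeasure_mono len_le_sets) auto
  finally have \<mu>: "emeasure M {x. len x \<le> q} = ennreal \<mu>" "\<mu> > 0"
    using fin by (simp_all add: \<mu>_def enn2real_positive_iff)
  define D where "D = 2 * q + 1"
  \<comment> \<open>With i0 = R + 2 * q, a point satisfying len x + q \<ge> i0 keeps len (\<pi> x)
    \<ge> R after rounding; L is the length that \<open>geodesic_translates\<close> requires for
    this i0.\<close>
  define L where "L = 2 * (R + 2 * q + D)"
  show ?thesis
  \<comment> \<open>The p-th power of an increment decays like exp (- \<epsilon> * p * len x), which
    is integrable once \<epsilon> * p \<ge> N.\<close>
  proof (intro exI[of _ "N / \<epsilon>"] allI impI)
    fix p assume "N / \<epsilon> \<le> p"
    then have "N \<le> \<epsilon> * p" using \<epsilon> by (simp add: field_simps)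
    have p: "p > 0" using \<open>N / \<epsilon> \<le> p\<close> N(1) \<epsilon> by (meson divide_pos_pos less_le_trans)
    note h_fin = pnorm_exp_len[OF N(2)[OF \<open>N \<le> \<epsilon> * p\<close>]]
    have [measurable]: "(\<lambda>x. C * exp (- \<epsilon> * real (len x))) \<in> borel_measurable M" for C
      by measurable
    have F_fin: "pnorm p (\<lambda>x. F i (x + g) - F i x) < \<infinity>" for g i
    proof -
      have "pnorm p (\<lambda>x. F i (x + g) - F i x) \<le>
          pnorm p (\<lambda>x. exp (\<epsilon> * real (len g + 2 * q)) * exp (- \<epsilon> * real (len x)))"
        using F_var[of g "len g"] by (intro pnorm_mono p) (simp add: abs_mult)
      also have "\<dots> < \<infinity>" by (rule h_fin)
      finally show ?thesis .
    qed
    have F_tcont: "tcont p (F i)" for i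
    proof (rule tcont_small_variation[OF p F_meas F_bound _ h_fin V])
      show "\<bar>F i (x + u) - F i x\<bar> \<le> \<bar>exp (\<epsilon> * real (q + 2 * q)) * exp (- \<epsilon> * real (len x))\<bar>"
        if "u \<in> V" for x u
        using F_var[OF V(3)[OF that], of i x] by (simp add: abs_mult)
    qed measurable
    \<comment> \<open>The separation c to the power p, times the measure of good points x per unit
      of length of g.\<close>
    define a where "a = c powr p * (\<mu> / (2 * real D))"
    have a: "a > 0" unfolding a_def using c \<mu>(2) by (simp add: D_def)
    let ?c = "coboundary F"
    have lower: "penergy p n (?c g) \<ge> ennreal (a * real (len g))" if g: "len g \<ge> L" for g
    proof -
      obtain A where A: "A \<in> sets M" "emeasure M A \<ge> ennreal (\<mu> / (2 * real D) * real (len g))"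
        "\<And>x. x \<in> A \<Longrightarrow> len x + q \<ge> R + 2 * q" "\<And>x. x \<in> A \<Longrightarrow> gp x (x + g) \<le> real q"
        by (rule geodesic_translates[OF \<mu> D_def, of "R + 2 * q" g]) (use g in \<open>simp add: L_def\<close>, rule that)
      have pw: "ennreal (c powr p) * indicator A x \<le> (\<Sum>i<n. ennreal (\<bar>?c g i x\<bar> powr p))" for x
      proof (cases "x \<in> A")
        case True
        have "len x \<le> len (\<pi> x) + q"
          using dst_triangle[of 0 x "\<pi> x"] \<pi>_dst[of x] by (simp add: dst_commute)
        then have "len (\<pi> x) \<ge> R" using A(3)[OF True] by simp
        moreover have "gp (\<pi> x) (\<pi> (x + g)) \<le> 3 * real q"
          using gp_perturb[OF \<pi>_dst[of x] \<pi>_dst[of "x + g"]] A(4)[OF True] by linarith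
        ultimately obtain i where i: "i < n" "c \<le> \<bar>F i x - F i (x + g)\<bar>"
          using sep[of "\<pi> x" "\<pi> (x + g)"] by (auto simp: z F_def)
        then have "c powr p \<le> \<bar>?c g i x\<bar> powr p"
          using c p by (intro powr_mono2) (auto simp: coboundary_def[OF p F_fin F_tcont] abs_minus_commute)
        then have "ennreal (c powr p) * indicator A x \<le> ennreal (\<bar>?c g i x\<bar> powr p)"
          using True by (simp add: ennreal_leI)
        also have "\<dots> \<le> (\<Sum>i<n. ennreal (\<bar>?c g i x\<bar> powr p))"
          using i(1) by (intro member_le_sum) auto
        finally show ?thesis .
      qed simp
      have "ennreal (a * real (len g)) = ennreal (c powr p) * ennreal (\<mu> / (2 * real D) * real (len g))"
        unfolding a_def using \<mu>(2) by (simp add: ennreal_mult[symmetric] mult.assoc)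
      also have "\<dots> \<le> ennreal (c powr p) * emeasure M A"
        using A(2) by (rule mult_left_mono) simp
      also have "\<dots> = (\<integral>\<^sup>+x. ennreal (c powr p) * indicator A x \<partial>M)"
        using A(1) by (simp add: nn_integral_cmult_indicator)
      also have "\<dots> \<le> (\<integral>\<^sup>+x. (\<Sum>i<n. ennreal (\<bar>?c g i x\<bar> powr p)) \<partial>M)"
        using pw by (intro nn_integral_mono)
      also have "\<dots> = penergy p n (?c g)"
        unfolding penergy_def pnorm_def
        using coboundary_meas[OF p F_fin F_tcont] by (intro nn_integral_sum) auto
      finally show ?thesis .
    qed
    have "\<exists>B. compact B \<and> {g. penergy p n (?c g) \<le> ennreal r} \<subseteq> B" for r
    proof (intro exI conjI subsetI)
      fix g assume "g \<in> {g. penergy p n (?c g) \<le> ennreal r}"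
      then have g: "penergy p n (?c g) \<le> ennreal \<bar>r\<bar>"
        by (auto intro: order_trans ennreal_leI)
      \<comment> \<open>Elements shorter than L escape the lower bound, but they lie in a compact
        ball anyway.\<close>
      show "g \<in> {g. len g \<le> max L (nat \<lceil>\<bar>r\<bar> / a\<rceil>)}"
      proof (cases "len g \<ge> L")
        case True
        have "ennreal (a * real (len g)) \<le> ennreal \<bar>r\<bar>"
          using lower[OF True] g by (rule order_trans)
        then have "a * real (len g) \<le> \<bar>r\<bar>" by (simp add: ennreal_le_iff)
        then have "real (len g) \<le> \<bar>r\<bar> / a" using a by (simp add: field_simps)
        also have "\<dots> \<le> real (nat \<lceil>\<bar>r\<bar> / a\<rceil>)" by (rule real_nat_ceiling_ge)
        finally show ?thesis by simp
      qed simp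
    qed (rule compact_len_le)
    then have "metrically_proper_action M p n ?c"
      by (rule coboundary_proper[OF p F_fin F_tcont])
    moreover have "continuous_affine_isometric_action M p n ?c"
      by (rule coboundary_action[OF p F_fin F_tcont])
    moreover have "\<forall>g. word_length S g \<ge> real L \<longrightarrow>
        Lp_dist M p n (?c g) (\<lambda>_ _. 0) \<ge> a powr (1 / p) * word_length S g powr (1 / p)"
    proof (intro allI impI)
      fix g assume "word_length S g \<ge> real L"
      then have "len g \<ge> L" by (simp add: word_length_eq)
      then have "(a * real (len g)) powr (1 / p) \<le> Lp_dist M p n (?c g) (\<lambda>_ _. 0)"
        using a by (intro coboundary_lower[OF p F_fin F_tcont] lower) auto
      then show "a powr (1 / p) * word_length S g powr (1 / p) \<le> Lp_dist M p n (?c g) (\<lambda>_ _. 0)"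
        using a by (simp add: powr_mult word_length_eq)
    qed
    moreover have "a powr (1 / p) > 0" using a by simp
    ultimately show "\<exists>n c. continuous_affine_isometric_action M p n c \<and>
           metrically_proper_action M p n c \<and>
           (\<exists>C>0. \<exists>K. \<forall>g. word_length S g \<ge> K \<longrightarrow>
               Lp_dist M p n (c g) (\<lambda>_ _. 0) \<ge> C * word_length S g powr (1 / p))"
      by blast
  qed
qed

end

theorem theorem5p1:
  fixes S :: "'g::{topological_group_add,t2_space} set"
    and M :: "'g measure"
  assumes "hyperbolic_lc_group S"
    and "non_elementary S"
    and "\<not> amenable_group TYPE('g)"
    and "right_haar_measure M"
  shows "\<exists>N. \<forall>p\<ge>N. \<exists>n c.
           continuous_affine_isometric_action M p n c \<and>
           metrically_proper_action M p n c \<and>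
           (\<exists>C>0. \<exists>K. \<forall>g. word_length S g \<ge> K \<longrightarrow>
               Lp_dist M p n (c g) (\<lambda>_ _. 0) \<ge> C * word_length S g powr (1 / p))"
proof -
  interpret hyperbolic_haar S M
    using assms(1,4) by unfold_locales (simp_all add: hyperbolic_lc_group_def)
  show ?thesis by (rule proper_affine_action)
qed

end
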